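(* Let $G$ be a planar, bipartite graph such that each vertex of $G$ has even degree. Then $G$ is the alternating decomposition graph of some link diagram $D$. Moreover, $D$ may be chosen to be adequate.
   Context: Graphs are finite and may have multiple edges. A link diagram $D$ is viewed as a $4$-valent graph on the sphere $S^2$ with over/under information at the vertices (crossings). An edge of $D$ is non-alternating if both of its ends are over-strands or both are under-strands at the crossings they meet; otherwise it is alternating. A diagram is alternating if all its edges are alternating. Alternating decomposition graph of $D$: for a connected diagram $D$, mark two distinct points on every non-alternating edge, and inside each face join by disjoint arcs those pairs of marked points that are adjacent along the boundary of the face but do not lie on the same edge of $D$; the arcs form disjoint simple closed curves $\gamma_1,\dots,\gamma_k$. If $D$ is connected and alternating, its alternating decomposition graph is a single vertex. If $D$ is connected and not alternating, the graph has vertices $v_1,\dots,v_k$ corresponding to the curves and one edge for each non-alternating edge of $D$, joining $v_i$ and $v_j$ where $\gamma_i,\gamma_j$ are the curves through the two marked points. For disconnected $D$ take the disjoint union over connected components. A state of $D$ is the collection of simple closed curves obtained by choosing an $A$-resolution or a $B$-resolution (Kauffman smoothing) at each crossing. $D$ is adequate if the number of curves in the all-$A$ state is strictly greater than the number of curves in every state with exactly one $B$-resolution, and the number of curves in the all-$B$ state is strictly greater than the number of curves in every state with exactly one $A$-resolution. *)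

theory Defs
  imports Main "HOL-Library.Multiset" "HOL-Combinatorics.Permutations" "HOL-Combinatorics.Orbits"
begin

section \<open>Finite undirected multigraphs\<close>

text \<open>The two ends of an edge form a multiset of size 2, so that a loop at a vertex
  contributes 2 to its degree.\<close>

record ('v, 'e) multigraph =
  verts :: "'v set"
  edges :: "'e set"
  ends :: "'e \<Rightarrow> 'v multiset"

definition finite_multigraph :: "('v, 'e) multigraph \<Rightarrow> bool" where
  "finite_multigraph G \<longleftrightarrow> finite (verts G) \<and> finite (edges G) \<and>
     (\<forall>e\<in>edges G. size (ends G e) = 2 \<and> set_mset (ends G e) \<subseteq> verts G)"

definition degree :: "('v, 'e) multigraph \<Rightarrow> 'v \<Rightarrow> nat" where
  "degree G v = (\<Sum>e\<in>edges G. count (ends G e) v)"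

definition bipartite :: "('v, 'e) multigraph \<Rightarrow> bool" where
  "bipartite G \<longleftrightarrow> (\<exists>X Y. X \<union> Y = verts G \<and> X \<inter> Y = {} \<and>
     (\<forall>e\<in>edges G. \<exists>x\<in>X. \<exists>y\<in>Y. ends G e = {#x, y#}))"

definition isomorphic :: "('v, 'e) multigraph \<Rightarrow> ('w, 'f) multigraph \<Rightarrow> bool" where
  "isomorphic G H \<longleftrightarrow> (\<exists>f g. bij_betw f (verts G) (verts H) \<and> bij_betw g (edges G) (edges H) \<and>
     (\<forall>e\<in>edges G. ends H (g e) = image_mset f (ends G e)))"

section \<open>Graphs on the sphere\<close>

text \<open>A graph embedded in an oriented surface is given by its darts (half-edges): \<open>opp\<close>
  exchanges the two darts of an edge, and \<open>rot\<close> sends a dart to the next one in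
  counterclockwise order around the vertex at which it is based. Thus the vertices, edges and
  faces are the orbits of \<open>rot\<close>, \<open>opp\<close> and \<open>rot \<circ> opp\<close>; the orbit of \<open>d\<close> under
  \<open>rot \<circ> opp\<close> is the boundary walk, beginning along \<open>d\<close>, of the face to the right of \<open>d\<close>.\<close>

record 'd comb_map =
  darts :: "'d set"
  opp :: "'d \<Rightarrow> 'd"
  rot :: "'d \<Rightarrow> 'd"

definition face_step :: "('d, 'z) comb_map_scheme \<Rightarrow> 'd \<Rightarrow> 'd" where
  "face_step M = rot M \<circ> opp M"

definition comb_map :: "('d, 'z) comb_map_scheme \<Rightarrow> bool" where
  "comb_map M \<longleftrightarrow> finite (darts M) \<and> opp M permutes darts M \<and> rot M permutes darts M \<and>
     (\<forall>d\<in>darts M. opp M d \<noteq> d \<and> opp M (opp M d) = d)"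

text \<open>As \<open>opp\<close> and \<open>rot\<close> are permutations of a finite set, forward reachability is symmetric.\<close>

definition component :: "('d, 'z) comb_map_scheme \<Rightarrow> 'd \<Rightarrow> 'd set" where
  "component M d =
     ({(x, opp M x) | x. x \<in> darts M} \<union> {(x, rot M x) | x. x \<in> darts M})\<^sup>* `` {d}"

definition components :: "('d, 'z) comb_map_scheme \<Rightarrow> 'd set set" where
  "components M = component M ` darts M"

text \<open>The surface on which a connected map is cellularly embedded is the sphere iff its Euler
  characteristic \<open>V - E + F\<close> is 2. A disconnected graph lies on the sphere iff each of
  its components does; the placement of a component inside a face of another one is not
  recorded, since none of the notions below depend on it.\<close>

definition spherical :: "('d, 'z) comb_map_scheme \<Rightarrow> bool" where
  "spherical M \<longleftrightarrow> (\<forall>C\<in>components M.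
     int (card (orbit (rot M) ` C)) - int (card (orbit (opp M) ` C))
       + int (card (orbit (face_step M) ` C)) = 2)"

text \<open>A drawing of \<open>G\<close> has two darts \<open>(e, False)\<close>, \<open>(e, True)\<close> for each edge \<open>e\<close>, and
  \<open>base\<close> tells at which vertex a dart starts. Isolated vertices carry no darts and impose no
  condition.\<close>

definition spherical_drawing ::
    "('v, 'e) multigraph \<Rightarrow> ('e \<times> bool \<Rightarrow> 'v) \<Rightarrow> ('e \<times> bool) comb_map \<Rightarrow> bool" where
  "spherical_drawing G base M \<longleftrightarrow> comb_map M \<and> spherical M \<and>
     darts M = edges G \<times> UNIV \<and>
     (\<forall>e\<in>edges G. \<forall>b. opp M (e, b) = (e, \<not> b)) \<and>
     (\<forall>e\<in>edges G. ends G e = {#base (e, False), base (e, True)#}) \<and>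
     (\<forall>d\<in>darts M. orbit (rot M) d = {d' \<in> darts M. base d' = base d})"

definition planar :: "('v, 'e) multigraph \<Rightarrow> bool" where
  "planar G \<longleftrightarrow> (\<exists>base M. spherical_drawing G base M)"

section \<open>Link diagrams\<close>

text \<open>\<open>over_end d\<close> holds iff the dart \<open>d\<close> belongs to the over-strand at the crossing where it
  is based. \<open>circles\<close> counts the components of the diagram that are simple closed curves
  without crossings, which have no darts.\<close>

record 'd link_diagram = "'d comb_map" +
  over_end :: "'d \<Rightarrow> bool"
  circles :: nat

definition link_diagram :: "'d link_diagram \<Rightarrow> bool" where
  "link_diagram D \<longleftrightarrow> comb_map D \<and> spherical D \<and>
     (\<forall>d\<in>darts D. card (orbit (rot D) d) = 4) \<and>
     (\<forall>d\<in>darts D. over_end D (rot D d) \<longleftrightarrow> \<not> over_end D d)"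

definition crossing :: "'d link_diagram \<Rightarrow> 'd \<Rightarrow> 'd set" where
  "crossing D d = orbit (rot D) d"

definition crossings :: "'d link_diagram \<Rightarrow> 'd set set" where
  "crossings D = crossing D ` darts D"

subsection \<open>The alternating decomposition graph\<close>

definition nonalternating :: "'d link_diagram \<Rightarrow> 'd set" where
  "nonalternating D = {d \<in> darts D. over_end D d \<longleftrightarrow> over_end D (opp D d)}"

text \<open>The darts in \<open>nonalternating D\<close> stand for the marked points: \<open>d\<close> is the one of the two
  points on the edge \<open>{d, opp D d}\<close> that is closer to the crossing where \<open>d\<close> is based. A
  boundary walk running along \<open>d\<close> meets the point \<open>d\<close>, then \<open>opp D d\<close>, and then the
  point \<open>d'\<close> where \<open>d'\<close> is the next non-alternating dart of the walk. Hence \<open>opp D d\<close>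
  and \<open>d'\<close> are joined by an arc in this face, unless they are on the same edge.\<close>

definition face_arcs :: "'d link_diagram \<Rightarrow> ('d \<times> 'd) set" where
  "face_arcs D = {(opp D d, d') | d d'. d \<in> nonalternating D \<and> d' \<in> nonalternating D \<and>
     d' \<notin> {d, opp D d} \<and>
     (\<exists>n>0. d' = (face_step D ^^ n) d \<and>
        (\<forall>m. 0 < m \<and> m < n \<longrightarrow> (face_step D ^^ m) d \<notin> nonalternating D))}"

text \<open>The closed curve through a marked point, represented by the set of all marked points
  on it.\<close>

definition curve :: "'d link_diagram \<Rightarrow> 'd \<Rightarrow> 'd set" where
  "curve D d = (face_arcs D \<union> (face_arcs D)\<inverse>)\<^sup>* `` {d}"

text \<open>Arcs stay within a component of the diagram, so collecting the curves of all components
  gives the disjoint union over the components; each alternating component, and each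
  component without crossings, contributes a single vertex.\<close>

datatype 'd adg_vertex = Curve "'d set" | Alternating "'d set" | Circle nat

definition adg :: "'d link_diagram \<Rightarrow> ('d adg_vertex, 'd set) multigraph" where
  "adg D = \<lparr>
     verts = {Curve (curve D d) | d. d \<in> nonalternating D} \<union>
             {Alternating C | C. C \<in> components D \<and> C \<inter> nonalternating D = {}} \<union>
             {Circle i | i. i < circles D},
     edges = {{d, opp D d} | d. d \<in> nonalternating D},
     ends = (\<lambda>e. image_mset (\<lambda>d. Curve (curve D d)) (mset_set e))\<rparr>"

subsection \<open>States and adequacy\<close>

text \<open>The A-regions at a crossing are swept out by turning the over-strand counterclockwise;
  they lie between an over-dart \<open>d\<close> and \<open>rot D d\<close>. The A-resolution joins these two regions
  and so connects each over-dart to the preceding under-dart; the B-resolution connects it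
  to the following one. A state is given by the set \<open>S\<close> of crossings with a
  B-resolution.\<close>

definition resolve :: "'d link_diagram \<Rightarrow> 'd set set \<Rightarrow> 'd \<Rightarrow> 'd" where
  "resolve D S d =
     (if over_end D d \<longleftrightarrow> crossing D d \<in> S then rot D d else inv (rot D) d)"

definition state_curve :: "'d link_diagram \<Rightarrow> 'd set set \<Rightarrow> 'd \<Rightarrow> 'd set" where
  "state_curve D S d =
     ({(x, opp D x) | x. x \<in> darts D} \<union> {(x, resolve D S x) | x. x \<in> darts D})\<^sup>* `` {d}"

definition num_state_curves :: "'d link_diagram \<Rightarrow> 'd set set \<Rightarrow> nat" where
  "num_state_curves D S = card (state_curve D S ` darts D) + circles D"

definition adequate :: "'d link_diagram \<Rightarrow> bool" where
  "adequate D \<longleftrightarrow>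
     (\<forall>c\<in>crossings D. num_state_curves D {} > num_state_curves D {c}) \<and>
     (\<forall>c\<in>crossings D.
        num_state_curves D (crossings D) > num_state_curves D (crossings D - {c}))"

end

theory Submission
  imports Defs
begin

text \<open>Each vertex of degree \<open>2k\<close> of a drawing of \<open>G\<close> is replaced by a ring
  that crosses the \<open>2k\<close> incident edges; inside the ring, the strands of these edges are joined in
  neighbouring pairs by \<open>k\<close> arcs; an isolated vertex becomes a circle without crossings. If the
  crossings of the edges with the ring alternate between over and under around the ring, then the tangle is
  alternating. If moreover each edge of \<open>G\<close> is over at both of its ends or under at both of them,
  then the non-alternating edges of the diagram are exactly the edges of \<open>G\<close>, and the curves are
  circles around the rings. Such a labelling of the edges exists: as \<open>G\<close> is even and drawn on the
  sphere, its faces have a proper 2-colouring, and the label of an edge is the colour of the face to the right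
  of the edge when it is directed from the first to the second class of the bipartition.

  In the all-A state the bigons in each ring are state curves, and in the all-B state the central regions are.
  Every crossing has such an inner curve on one side and a curve running outside of the rings on the other, so
  changing one resolution merges two curves.\<close>

section \<open>Orbits and invariant sets\<close>

text \<open>If the permutation \<open>p\<close> preserves \<open>C\<close>, these are the unions of
  \<open>p\<close>-orbits in \<open>C\<close>. Under symmetric difference they form a vector space
  over the field with two elements whose dimension is the number of orbits, so that numbers of
  vertices, edges and faces become dimensions.\<close>

definition invariant_sets :: "('a \<Rightarrow> 'a) \<Rightarrow> 'a set \<Rightarrow> 'a set set" where
  "invariant_sets p C = {B. B \<subseteq> C \<and> (\<forall>x\<in>C. p x \<in> B \<longleftrightarrow> x \<in> B)}"

text \<open>An injective self-map of a finite set is onto, so forward closure already gives closure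
  under preimages.\<close>

lemma closed_imp_invariant:
  assumes "p permutes A" "finite A" "B \<subseteq> A" "\<And>x. x \<in> B \<Longrightarrow> p x \<in> B"
  shows "p x \<in> B \<longleftrightarrow> x \<in> B"
proof
  have inj: "inj p" using assms(1) by (rule permutes_inj)
  have "p ` B = B"
    using assms inj by (intro endo_inj_surj) (auto intro: finite_subset inj_on_subset)
  moreover assume "p x \<in> B"
  ultimately show "x \<in> B" using inj by (metis imageE injD)
qed (use assms in auto)

lemma permutes_self_in_orbit: "p permutes A \<Longrightarrow> finite A \<Longrightarrow> x \<in> orbit p x"
  by (intro permutation_self_in_orbit) (auto simp: permutation_permutes)

lemma permutes_orbit_step: "p permutes A \<Longrightarrow> finite A \<Longrightarrow> orbit p (p x) = orbit p x"
  by (intro permutation_orbit_step) (auto simp: permutation_permutes)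

lemma orbit_eq_iff:
  assumes "p permutes A" "finite A"
  shows "orbit p x = orbit p y \<longleftrightarrow> x \<in> orbit p y"
proof
  show "x \<in> orbit p y" if "orbit p x = orbit p y"
    using permutes_self_in_orbit[OF assms, of x] that by simp
  show "orbit p x = orbit p y" if "x \<in> orbit p y"
    by (rule orbit_cyclic_eq3[OF cyclic_on_orbit[OF assms] that])
qed

lemma orbit_subset_closed: "x \<in> B \<Longrightarrow> (\<And>y. y \<in> B \<Longrightarrow> p y \<in> B) \<Longrightarrow> orbit p x \<subseteq> B"
proof
  fix y assume a: "x \<in> B" "\<And>y. y \<in> B \<Longrightarrow> p y \<in> B" "y \<in> orbit p x"
  show "y \<in> B" using a(3,1,2) by induction auto
qed

lemma invariant_sets_orbit:
  assumes "B \<in> invariant_sets p C" "\<And>x. x \<in> C \<Longrightarrow> p x \<in> C" "x \<in> B"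
  shows "orbit p x \<subseteq> B"
  using assms by (intro orbit_subset_closed) (auto simp: invariant_sets_def)

lemma finite_invariant_sets: "finite C \<Longrightarrow> finite (invariant_sets p C)"
  by (rule finite_subset[of _ "Pow C"]) (auto simp: invariant_sets_def)

text \<open>An invariant set is the union of the orbits that it meets, so \<open>Union\<close> is a
  bijection from sets of orbits onto invariant sets.\<close>

lemma card_invariant_sets:
  assumes p: "p permutes A" "finite A" and C: "C \<subseteq> A" "\<And>x. x \<in> C \<Longrightarrow> p x \<in> C"
  shows "card (invariant_sets p C) = 2 ^ card (orbit p ` C)"
proof -
  have sub: "orbit p x \<subseteq> C" if "x \<in> C" for x
    using that C(2) by (rule orbit_subset_closed)
  have self: "x \<in> orbit p x" for x using p by (rule permutes_self_in_orbit)
  have "bij_betw Union (Pow (orbit p ` C)) (invariant_sets p C)"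
  proof (rule bij_betwI[where g = "\<lambda>B. orbit p ` B"])
    show "Union \<in> Pow (orbit p ` C) \<rightarrow> invariant_sets p C"
    proof
      fix S assume S: "S \<in> Pow (orbit p ` C)"
      have "p x \<in> orbit p y \<longleftrightarrow> x \<in> orbit p y" for x y
        unfolding orbit_eq_iff[OF p, symmetric] permutes_orbit_step[OF p] ..
      then have "p x \<in> s \<longleftrightarrow> x \<in> s" if "s \<in> S" for x s using S that by auto
      then have "p x \<in> \<Union>S \<longleftrightarrow> x \<in> \<Union>S" for x by auto
      moreover have "\<Union>S \<subseteq> C" using S sub by auto
      ultimately show "\<Union>S \<in> invariant_sets p C" by (simp add: invariant_sets_def)
    qed
    show "(\<lambda>B. orbit p ` B) \<in> invariant_sets p C \<rightarrow> Pow (orbit p ` C)"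
      by (auto simp: invariant_sets_def)
    show "orbit p ` \<Union>S = S" if S: "S \<in> Pow (orbit p ` C)" for S
    proof -
      have *: "orbit p x = orbit p y" if "x \<in> orbit p y" for x y
        using that orbit_eq_iff[OF p] by blast
      show ?thesis
      proof (intro equalityI subsetI)
        fix z assume "z \<in> orbit p ` \<Union>S"
        then obtain x s where x: "z = orbit p x" "x \<in> s" "s \<in> S" by auto
        moreover from this obtain y where "s = orbit p y" using S by auto
        ultimately show "z \<in> S" using *[of x y] by simp
      next
        fix z assume z: "z \<in> S"
        then obtain y where "z = orbit p y" using S by auto
        then show "z \<in> orbit p ` \<Union>S" using z self[of y] by (metis UnionI imageI)
      qed
    qed
    show "\<Union> (orbit p ` B) = B" if "B \<in> invariant_sets p C" for B
    proof
      show "\<Union> (orbit p ` B) \<subseteq> B" using invariant_sets_orbit[OF that C(2)] by auto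
      show "B \<subseteq> \<Union> (orbit p ` B)" using self by auto
    qed
  qed
  then have "card (invariant_sets p C) = card (Pow (orbit p ` C))"
    by (rule bij_betw_same_card[symmetric])
  moreover have "finite C" using C(1) p(2) finite_subset by blast
  ultimately show ?thesis by (simp add: card_Pow)
qed

text \<open>Two maps with the same fibres take equally many values. This serves to count faces of
  the ring diagram by faces or vertices of the original map.\<close>

lemma card_image_cong_kernel:
  assumes "\<And>x y. x \<in> S \<Longrightarrow> y \<in> S \<Longrightarrow> f x = f y \<longleftrightarrow> g x = g y"
  shows "card (f ` S) = card (g ` S)"
proof -
  have "bij_betw (\<lambda>z. g (inv_into S f z)) (f ` S) (g ` S)"
  proof (rule bij_betwI[where g = "\<lambda>z. f (inv_into S g z)"])
    have *: "f (inv_into S f (f x)) = f x" "g (inv_into S g (g x)) = g x"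
      "inv_into S f (f x) \<in> S" "inv_into S g (g x) \<in> S" if "x \<in> S" for x
      using that by (auto simp: f_inv_into_f inv_into_into)
    then have **: "g (inv_into S f (f x)) = g x" "f (inv_into S g (g x)) = f x" if "x \<in> S" for x
      using that assms by metis+
    show "(\<lambda>z. g (inv_into S f z)) \<in> f ` S \<rightarrow> g ` S" "(\<lambda>z. f (inv_into S g z)) \<in> g ` S \<rightarrow> f ` S"
      using * by auto
    show "f (inv_into S g (g (inv_into S f z))) = z" if "z \<in> f ` S" for z
      using that * ** by auto
    show "g (inv_into S f (f (inv_into S g z))) = z" if "z \<in> g ` S" for z
      using that * ** by auto
  qed
  then show ?thesis by (rule bij_betw_same_card)
qed

section \<open>Symmetric differences\<close>

definition symd :: "'a set \<Rightarrow> 'a set \<Rightarrow> 'a set" where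
  "symd A B = {x. (x \<in> A) \<noteq> (x \<in> B)}"

lemma in_symd: "x \<in> symd A B \<longleftrightarrow> (x \<in> A) \<noteq> (x \<in> B)"
  by (simp add: symd_def)

lemma symd_simps [simp]:
  "symd A A = {}" "symd {} A = A" "symd A {} = A" "symd A (symd A B) = B"
  "symd (symd A B) B = A"
  by (auto simp: symd_def)

lemma symd_assoc: "symd (symd A B) C = symd A (symd B C)" by (auto simp: symd_def)

lemma odd_card_symd:
  assumes "finite A" "finite B"
  shows "odd (card (symd A B)) \<longleftrightarrow> odd (card A) \<noteq> odd (card B)"
proof -
  have s: "symd A B = (A - B) \<union> (B - A)" by (auto simp: symd_def)
  have "card (symd A B) = card (A - B) + card (B - A)"
    unfolding s using assms by (intro card_Un_disjoint) auto
  moreover have "card A = card (A - B) + card (A \<inter> B)"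
    using assms by (metis add.commute card_Int_Diff)
  moreover have "card B = card (B - A) + card (A \<inter> B)"
    using assms by (metis add.commute card_Int_Diff Int_commute)
  ultimately show ?thesis by auto
qed

text \<open>Rank-nullity over the field with two elements, in multiplicative form: once a preimage
  \<open>s y\<close> is chosen for every value \<open>y\<close>, each element is uniquely the sum of
  a kernel element and some \<open>s y\<close>.\<close>

lemma card_kernel_image:
  assumes "finite X" and X: "\<And>A B. A \<in> X \<Longrightarrow> B \<in> X \<Longrightarrow> symd A B \<in> X"
    and f: "\<And>A B. A \<in> X \<Longrightarrow> B \<in> X \<Longrightarrow> f (symd A B) = symd (f A) (f B)"
  shows "card X = card {A \<in> X. f A = {}} * card (f ` X)"
proof -
  define s where "s = inv_into X f"
  have s: "s y \<in> X" "f (s y) = y" if "y \<in> f ` X" for y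
    using that by (auto simp: s_def inv_into_into f_inv_into_f)
  have "bij_betw (\<lambda>(k, y). symd k (s y)) ({A \<in> X. f A = {}} \<times> f ` X) X"
    by (rule bij_betwI[where g = "\<lambda>A. (symd A (s (f A)), f A)"]) (auto simp: s X f)
  from bij_betw_same_card[OF this] show ?thesis by (simp add: card_cartesian_product)
qed

lemma symd_in_invariant_sets:
  "A \<in> invariant_sets p C \<Longrightarrow> B \<in> invariant_sets p C \<Longrightarrow> symd A B \<in> invariant_sets p C"
  by (auto simp: invariant_sets_def in_symd)

section \<open>Two-colouring the faces of an Eulerian map\<close>

lemma component_self: "d \<in> component M d"
  by (auto simp: component_def)

lemma component_step:
  assumes "x \<in> component M d" "x \<in> darts M"
  shows "opp M x \<in> component M d" "rot M x \<in> component M d"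
  using assms unfolding component_def by (auto elim!: rtrancl_into_rtrancl)

lemma component_induct [consumes 1, case_names base opp rot]:
  assumes "x \<in> component M d" "P d"
    and "\<And>y. y \<in> component M d \<Longrightarrow> y \<in> darts M \<Longrightarrow> P y \<Longrightarrow> P (opp M y)"
    and "\<And>y. y \<in> component M d \<Longrightarrow> y \<in> darts M \<Longrightarrow> P y \<Longrightarrow> P (rot M y)"
  shows "P x"
proof -
  have "(d, x) \<in> ({(x, opp M x) | x. x \<in> darts M} \<union> {(x, rot M x) | x. x \<in> darts M})\<^sup>*"
    using assms(1) by (simp add: component_def)
  then show ?thesis
    by induction (use assms(2-) in \<open>auto simp: component_def\<close>)
qed

locale combinatorial_map =
  fixes M :: "('a, 'z) comb_map_scheme"
  assumes comb_map: "comb_map M"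
begin

abbreviation "A \<equiv> darts M"
abbreviation "\<alpha> \<equiv> opp M"
abbreviation "\<rho> \<equiv> rot M"
abbreviation "\<phi> \<equiv> face_step M"

lemma finite_A: "finite A" and o_perm: "\<alpha> permutes A" and r_perm: "\<rho> permutes A"
  using comb_map by (auto simp: comb_map_def)

lemma o_simps: "d \<in> A \<Longrightarrow> \<alpha> d \<noteq> d" "d \<in> A \<Longrightarrow> \<alpha> (\<alpha> d) = d"
  using comb_map by (auto simp: comb_map_def)

lemma o_in: "\<alpha> d \<in> A \<longleftrightarrow> d \<in> A" and r_in: "\<rho> d \<in> A \<longleftrightarrow> d \<in> A"
  using o_perm r_perm by (auto simp: permutes_in_image)

lemma face_perm: "\<phi> permutes A"
  unfolding face_step_def using o_perm r_perm by (rule permutes_compose)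

lemma component_subset: "d \<in> A \<Longrightarrow> component M d \<subseteq> A"
proof
  fix x assume "d \<in> A" "x \<in> component M d"
  from this(2,1) show "x \<in> A" by (induction rule: component_induct) (auto simp: o_in r_in)
qed

lemma component_iff:
  assumes "d \<in> A"
  shows "\<alpha> x \<in> component M d \<longleftrightarrow> x \<in> component M d"
    "\<rho> x \<in> component M d \<longleftrightarrow> x \<in> component M d"
  by (rule closed_imp_invariant[OF o_perm finite_A component_subset[OF assms]]
      closed_imp_invariant[OF r_perm finite_A component_subset[OF assms]],
      use component_subset[OF assms] component_step[of _ M d] in blast)+

text \<open>Membership in an invariant set is transported along every step from \<open>d\<close>,
  hence is constant on the component.\<close>

lemma component_connected:
  assumes "d \<in> A" "B \<subseteq> component M d" "B \<noteq> {}"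
    and inv: "\<And>x. x \<in> component M d \<Longrightarrow> \<alpha> x \<in> B \<longleftrightarrow> x \<in> B"
      "\<And>x. x \<in> component M d \<Longrightarrow> \<rho> x \<in> B \<longleftrightarrow> x \<in> B"
  shows "B = component M d"
proof -
  have "x \<in> B \<longleftrightarrow> d \<in> B" if "x \<in> component M d" for x
    using that by (induction rule: component_induct) (auto simp: inv)
  then show ?thesis using assms(2,3) by blast
qed

lemma component_eq:
  assumes "d \<in> A" "x \<in> component M d"
  shows "component M x = component M d"
proof (rule component_connected)
  have x: "x \<in> A" using assms component_subset by blast
  show "component M x \<subseteq> component M d"
  proof
    fix y assume "y \<in> component M x"
    then show "y \<in> component M d"
      by (induction rule: component_induct) (auto simp: assms component_iff)
  qed
  show "component M x \<noteq> {}" using component_self[of x M] by auto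
  show "\<alpha> y \<in> component M x \<longleftrightarrow> y \<in> component M x" for y by (simp add: component_iff x)
  show "\<rho> y \<in> component M x \<longleftrightarrow> y \<in> component M x" for y by (simp add: component_iff x)
qed fact

text \<open>The orbits of the fixed-point-free involution \<open>\<alpha>\<close> are disjoint
  pairs.\<close>

lemma card_edges:
  assumes "S \<subseteq> A" "\<And>x. x \<in> S \<Longrightarrow> \<alpha> x \<in> S"
  shows "2 * card (orbit \<alpha> ` S) = card S"
proof -
  have o: "orbit \<alpha> x = {x, \<alpha> x}" if "x \<in> A" for x
  proof
    show "orbit \<alpha> x \<subseteq> {x, \<alpha> x}" using o_simps(2)[OF that] by (intro orbit_subset_closed) auto
    show "{x, \<alpha> x} \<subseteq> orbit \<alpha> x"
      using permutes_self_in_orbit[OF o_perm finite_A] orbit.base[of \<alpha> x] by auto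
  qed
  have fin: "finite S" using finite_A assms(1) by (rule rev_finite_subset)
  have un: "\<Union> (orbit \<alpha> ` S) = S" using o assms by (fastforce simp: subset_iff)
  have "2 * card (orbit \<alpha> ` S) = card (\<Union> (orbit \<alpha> ` S))"
  proof (rule card_partition)
    show "card e = 2" if e: "e \<in> orbit \<alpha> ` S" for e
    proof -
      obtain x where x: "x \<in> S" "e = orbit \<alpha> x" using e by blast
      then have "x \<in> A" using assms(1) by blast
      then show ?thesis using o[of x] o_simps(1)[of x] x by simp
    qed
    show "e \<inter> e' = {}" if "e \<in> orbit \<alpha> ` S" "e' \<in> orbit \<alpha> ` S" "e \<noteq> e'" for e e'
    proof (rule ccontr)
      assume "e \<inter> e' \<noteq> {}"
      then obtain z where "z \<in> e" "z \<in> e'" by blast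
      then have "orbit \<alpha> z = e" "orbit \<alpha> z = e'"
        using that(1,2) orbit_eq_iff[OF o_perm finite_A] by blast+
      then show False using that(3) by simp
    qed
  qed (use fin un in auto)
  then show ?thesis by (simp add: un)
qed

text \<open>A homology argument: on a sphere, every set of edges that meets each vertex in an even
  number of darts bounds a set of faces. As all degrees are even, this applies to the set of all
  edges, and the faces that it bounds form one colour class. A dart is in \<open>B\<close> iff the
  face to its right has that colour.\<close>

lemma component_two_colouring:
  assumes d: "d0 \<in> A" and ev: "\<And>d. d \<in> A \<Longrightarrow> even (card (orbit \<rho> d))"
    and euler: "int (card (orbit \<rho> ` component M d0)) - int (card (orbit \<alpha> ` component M d0))
       + int (card (orbit \<phi> ` component M d0)) = 2"
  shows "\<exists>B. (\<forall>x\<in>component M d0. \<phi> x \<in> B \<longleftrightarrow> x \<in> B) \<and> (\<forall>x\<in>component M d0. \<alpha> x \<in> B \<longleftrightarrow> x \<notin> B)"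
proof -
  define C where "C = component M d0"
  have CA: "C \<subseteq> A" unfolding C_def using d by (rule component_subset)
  then have fC: "finite C" using finite_A finite_subset by blast
  have oC: "\<alpha> x \<in> C \<longleftrightarrow> x \<in> C" and rC: "\<rho> x \<in> C \<longleftrightarrow> x \<in> C" for x
    by (simp_all add: C_def component_iff d)
  have \<phi>C: "\<phi> x \<in> C \<longleftrightarrow> x \<in> C" for x by (simp add: face_step_def oC rC)
  have oo: "\<alpha> (\<alpha> x) = x" if "x \<in> C" for x using that CA o_simps by blast
  define V E F where "V = invariant_sets \<rho> C" and "E = invariant_sets \<alpha> C"
    and "F = invariant_sets \<phi> C"
  have cV: "card V = 2 ^ card (orbit \<rho> ` C)"
    unfolding V_def by (rule card_invariant_sets[OF r_perm finite_A CA]) (simp add: rC)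
  have cE: "card E = 2 ^ card (orbit \<alpha> ` C)"
    unfolding E_def by (rule card_invariant_sets[OF o_perm finite_A CA]) (simp add: oC)
  have cF: "card F = 2 ^ card (orbit \<phi> ` C)"
    unfolding F_def by (rule card_invariant_sets[OF face_perm finite_A CA]) (simp add: \<phi>C)
  have "card (orbit \<rho> ` C) + card (orbit \<phi> ` C) = 2 + card (orbit \<alpha> ` C)"
    using euler unfolding C_def by linarith
  \<comment> \<open>Euler's formula, exponentiated; the factor 4 is 2 to the power of the Euler
    characteristic.\<close>
  from arg_cong[OF this, of "\<lambda>n. (2::nat) ^ n"] have VF: "card V * card F = 4 * card E"
    unfolding cV cE cF by (simp add: power_add)
  have fin: "finite V" "finite E" "finite F"
    unfolding V_def E_def F_def by (simp_all add: finite_invariant_sets fC)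
  \<comment> \<open>The boundary maps from faces to edges and from edges to vertices, mod 2. By Euler's formula
    and dimension counting, the complex is exact at the edges.\<close>
  define \<gamma> where "\<gamma> = (\<lambda>B. {x \<in> C. (x \<in> B) \<noteq> (\<alpha> x \<in> B)})"
  define \<delta> where "\<delta> = (\<lambda>T. {x \<in> C. odd (card (T \<inter> orbit \<rho> x))})"
  have orb: "x \<in> orbit \<rho> y \<longleftrightarrow> orbit \<rho> x = orbit \<rho> y" for x y
    using orbit_eq_iff[OF r_perm finite_A] by blast
  have orbs: "orbit \<rho> (\<rho> x) = orbit \<rho> x" for x
    using permutes_orbit_step[OF r_perm finite_A] by blast
  have orbC: "orbit \<rho> x \<subseteq> C" if "x \<in> C" for x
    using that rC by (intro orbit_subset_closed) auto
  have h2: "\<gamma> (symd P Q) = symd (\<gamma> P) (\<gamma> Q)" for P Q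
    unfolding \<gamma>_def set_eq_iff in_symd mem_Collect_eq by (intro allI) argo
  have h1: "\<delta> (symd P Q) = symd (\<delta> P) (\<delta> Q)" if "P \<subseteq> C" "Q \<subseteq> C" for P Q
  proof -
    have *: "odd (card (symd P Q \<inter> Z)) \<longleftrightarrow> odd (card (P \<inter> Z)) \<noteq> odd (card (Q \<inter> Z))" for Z
    proof -
      have "symd P Q \<inter> Z = symd (P \<inter> Z) (Q \<inter> Z)" by (auto simp: in_symd)
      moreover have "finite P" "finite Q" using that fC by (auto intro: finite_subset)
      ultimately show ?thesis by (simp add: odd_card_symd)
    qed
    show ?thesis unfolding \<delta>_def set_eq_iff in_symd mem_Collect_eq * by (intro allI) argo
  qed
  have F1: "card F = card {B \<in> F. \<gamma> B = {}} * card (\<gamma> ` F)"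
    using fin by (intro card_kernel_image h2) (auto simp: F_def symd_in_invariant_sets)
  have E1: "card E = card {T \<in> E. \<delta> T = {}} * card (\<delta> ` E)"
    using fin by (intro card_kernel_image h1)
      (auto simp: E_def symd_in_invariant_sets invariant_sets_def in_symd)
  \<comment> \<open>A set of faces without boundary is invariant under \<open>\<alpha>\<close>, and
    then also under \<open>\<rho>\<close>, since \<open>\<rho> x\<close> equals
    \<open>\<phi> (\<alpha> x)\<close>; connectedness leaves two possibilities.\<close>
  have "{B \<in> F. \<gamma> B = {}} \<subseteq> {{}, C}"
  proof
    fix B assume "B \<in> {B \<in> F. \<gamma> B = {}}"
    then have B: "B \<subseteq> C" "\<And>x. x \<in> C \<Longrightarrow> \<phi> x \<in> B \<longleftrightarrow> x \<in> B"
      "\<And>x. x \<in> C \<Longrightarrow> \<alpha> x \<in> B \<longleftrightarrow> x \<in> B"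
      by (auto simp: F_def invariant_sets_def \<gamma>_def)
    have "\<rho> x \<in> B \<longleftrightarrow> x \<in> B" if "x \<in> C" for x
      using B(2)[of "\<alpha> x"] B(3)[of x] that by (simp add: oC face_step_def oo)
    then show "B \<in> {{}, C}"
      using component_connected[OF d, of B] B by (auto simp: C_def[symmetric])
  qed
  then have "card {B \<in> F. \<gamma> B = {}} \<le> card {{}, C}" by (intro card_mono) auto
  also have "\<dots> \<le> 2" by (simp add: card_insert_if)
  finally have F2: "card F \<le> 2 * card (\<gamma> ` F)" using F1 by simp
  have clE: "symd P Q \<in> \<delta> ` E" if "P \<in> \<delta> ` E" "Q \<in> \<delta> ` E" for P Q
  proof -
    from that obtain P' Q' where "P' \<in> E" "P = \<delta> P'" "Q' \<in> E" "Q = \<delta> Q'" by blast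
    moreover from this have "\<delta> (symd P' Q') = symd P Q"
      by (simp add: h1 E_def invariant_sets_def)
    ultimately show ?thesis using symd_in_invariant_sets unfolding E_def by blast
  qed
  have "{} \<in> E" by (auto simp: E_def invariant_sets_def)
  moreover have "\<delta> {} = {}" by (simp add: \<delta>_def)
  ultimately have e0: "{} \<in> \<delta> ` E" by force
  \<comment> \<open>The boundary of a single edge is the sum of its two end vertices, which is empty
    for a loop.\<close>
  have edge: "symd (orbit \<rho> x) (orbit \<rho> (\<alpha> x)) \<in> \<delta> ` E" if x: "x \<in> C" for x
  proof -
    have "\<alpha> y \<in> {x, \<alpha> x} \<longleftrightarrow> y \<in> {x, \<alpha> x}" if "y \<in> C" for y
    proof -
      have "\<alpha> y = x \<longleftrightarrow> y = \<alpha> x" "\<alpha> y = \<alpha> x \<longleftrightarrow> y = x"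
        using oo[OF x] oo[OF that] by metis+
      then show ?thesis by blast
    qed
    then have "{x, \<alpha> x} \<in> E" using x oC by (simp add: E_def invariant_sets_def)
    moreover have "\<delta> {x, \<alpha> x} = symd (orbit \<rho> x) (orbit \<rho> (\<alpha> x))"
    proof -
      have "y \<in> \<delta> {x, \<alpha> x} \<longleftrightarrow> y \<in> symd (orbit \<rho> x) (orbit \<rho> (\<alpha> x))" for y
      proof -
        have "x \<noteq> \<alpha> x" using x CA o_simps by (metis subsetD)
        then have "card ({x, \<alpha> x} \<inter> orbit \<rho> y) = of_bool (x \<in> orbit \<rho> y) + of_bool (\<alpha> x \<in> orbit \<rho> y)"
          by (auto simp: Int_insert_left)
        then have "odd (card ({x, \<alpha> x} \<inter> orbit \<rho> y)) \<longleftrightarrow> (x \<in> orbit \<rho> y) \<noteq> (\<alpha> x \<in> orbit \<rho> y)"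
          by simp
        also have "\<dots> \<longleftrightarrow> y \<in> symd (orbit \<rho> x) (orbit \<rho> (\<alpha> x))"
          unfolding in_symd orb by metis
        finally show ?thesis
          using orbC[OF x] orbC[of "\<alpha> x"] x oC by (auto simp: \<delta>_def in_symd)
      qed
      then show ?thesis by blast
    qed
    ultimately show ?thesis by force
  qed
  \<comment> \<open>Along a path from \<open>d0\<close> the boundaries of the edges telescope, so
    any vertex differs from that of \<open>d0\<close> by a boundary.\<close>
  have conn: "symd (orbit \<rho> x) (orbit \<rho> d0) \<in> \<delta> ` E" if "x \<in> C" for x
    using that unfolding C_def
  proof (induction rule: component_induct)
    case base then show ?case using e0 by simp
  next
    case (opp y)
    have "symd (orbit \<rho> (\<alpha> y)) (orbit \<rho> d0)
        = symd (symd (orbit \<rho> y) (orbit \<rho> (\<alpha> y))) (symd (orbit \<rho> y) (orbit \<rho> d0))"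
      by (auto simp: symd_def)
    then show ?case using clE[OF edge opp(3)] opp(1) by (simp add: C_def)
  qed (simp add: orbs)
  \<comment> \<open>The image of \<open>\<delta>\<close> together with its translate by one vertex.
    It is closed under sums and contains every vertex, hence all of \<open>V\<close>; so the image
    has index at most 2 in \<open>V\<close>.\<close>
  define J where "J = \<delta> ` E \<union> symd (orbit \<rho> d0) ` \<delta> ` E"
  have J: "symd P Q \<in> J" if "P \<in> J" "Q \<in> J" for P Q
  proof -
    have *: "symd (orbit \<rho> d0) P \<in> \<delta> ` E" if "P \<in> J" "P \<notin> \<delta> ` E" for P
      using that by (auto simp: J_def)
    have J': "P \<in> J" if "symd (orbit \<rho> d0) P \<in> \<delta> ` E" for P
      unfolding J_def by (rule UnI2, rule image_eqI[OF _ that]) simp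
    consider "P \<in> \<delta> ` E" "Q \<in> \<delta> ` E" | "P \<notin> \<delta> ` E" "Q \<in> \<delta> ` E"
      | "P \<in> \<delta> ` E" "Q \<notin> \<delta> ` E" | "P \<notin> \<delta> ` E" "Q \<notin> \<delta> ` E" by blast
    then show ?thesis
    proof cases
      case 1 then show ?thesis using clE unfolding J_def by blast
    next
      case 2
      show ?thesis
        using clE[OF *[OF that(1) 2(1)] 2(2)] by (intro J') (simp add: symd_assoc)
    next
      case 3
      have "symd (orbit \<rho> d0) (symd P Q) = symd P (symd (orbit \<rho> d0) Q)"
        by (auto simp: symd_def)
      then show ?thesis using clE[OF 3(1) *[OF that(2) 3(2)]] by (intro J') simp
    next
      case 4
      have "symd P Q = symd (symd (orbit \<rho> d0) P) (symd (orbit \<rho> d0) Q)"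
        by (auto simp: symd_def)
      then show ?thesis
        using clE[OF *[OF that(1) 4(1)] *[OF that(2) 4(2)]] unfolding J_def by simp
    qed
  qed
  have J0: "{} \<in> J" using e0 by (simp add: J_def)
  have J1: "orbit \<rho> x \<in> J" if "x \<in> C" for x
  proof -
    have "orbit \<rho> x = symd (orbit \<rho> d0) (symd (orbit \<rho> x) (orbit \<rho> d0))"
      by (auto simp: symd_def)
    then show ?thesis using conn[OF that] unfolding J_def by blast
  qed
  \<comment> \<open>An invariant set is a finite sum of vertex orbits, removed one at a
    time.\<close>
  have "B \<in> J" if "B \<in> V" for B
  proof -
    have VC: "B \<subseteq> C" "finite B"
      using that fC by (auto simp: V_def invariant_sets_def intro: finite_subset)
    have vo: "orbit \<rho> x \<subseteq> B" if "B \<in> V" "x \<in> B" for x B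
      using that invariant_sets_orbit rC unfolding V_def by metis
    from VC(2,1) that show ?thesis
    proof (induction B rule: finite_psubset_induct)
      case (psubset B)
      show ?case
      proof (cases "B = {}")
        case False
        then obtain x where x: "x \<in> B" by blast
        then have xC: "x \<in> C" using psubset by blast
        have "orbit \<rho> x \<in> V"
          using orbC[OF xC] by (auto simp: V_def invariant_sets_def orb orbs)
        then have "symd (orbit \<rho> x) B \<in> V"
          using psubset by (simp add: V_def symd_in_invariant_sets)
        moreover have "symd (orbit \<rho> x) B \<subset> B"
          using vo[OF psubset(4) x] x permutes_self_in_orbit[OF r_perm finite_A, of x]
          by (auto simp: symd_def)
        ultimately have "symd (orbit \<rho> x) B \<in> J" using psubset by blast
        from J[OF J1[OF xC] this] show ?thesis by simp
      qed (simp add: J0)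
    qed
  qed
  then have "card V \<le> card J" using fin by (intro card_mono) (auto simp: J_def)
  also have "\<dots> \<le> card (\<delta> ` E) + card (\<delta> ` E)"
    unfolding J_def using fin
    by (intro order_trans[OF card_Un_le] add_mono card_image_le) auto
  finally have V2: "card V \<le> 2 * card (\<delta> ` E)" by simp
  \<comment> \<open>The boundary of a boundary vanishes: \<open>\<alpha> y\<close> and
    \<open>\<rho> y\<close> lie on the same face, so at each vertex \<open>T\<close> is the sum of
    \<open>B\<close> and its preimage under \<open>\<rho>\<close>, two sets of equal size.\<close>
  have sub: "\<gamma> ` F \<subseteq> {T \<in> E. \<delta> T = {}}"
  proof
    fix T assume "T \<in> \<gamma> ` F"
    then obtain B where B: "B \<in> F" and T: "T = \<gamma> B" by blast
    then have BC: "B \<subseteq> C" "\<And>x. x \<in> C \<Longrightarrow> \<phi> x \<in> B \<longleftrightarrow> x \<in> B"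
      by (auto simp: F_def invariant_sets_def)
    have "\<alpha> y \<in> T \<longleftrightarrow> y \<in> T" if "y \<in> C" for y
      unfolding T \<gamma>_def mem_Collect_eq oC oo[OF that] by (simp add: eq_commute)
    then have "T \<in> E" by (simp add: T E_def invariant_sets_def \<gamma>_def)
    moreover have "even (card (T \<inter> orbit \<rho> x))" if x: "x \<in> C" for x
    proof -
      have fO: "finite (orbit \<rho> x)" using orbC[OF x] fC finite_subset by blast
      have "\<alpha> y \<in> B \<longleftrightarrow> \<rho> y \<in> B" if "y \<in> C" for y
        using BC(2)[of "\<alpha> y"] that oC oo by (simp add: face_step_def)
      then have "y \<in> T \<longleftrightarrow> (y \<in> B) \<noteq> (\<rho> y \<in> B)" if "y \<in> orbit \<rho> x" for y
        using orbC[OF x] that by (auto simp: T \<gamma>_def)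
      then have T': "T \<inter> orbit \<rho> x = symd (B \<inter> orbit \<rho> x) {y \<in> orbit \<rho> x. \<rho> y \<in> B}"
        unfolding symd_def by blast
      have "\<rho> ` {y \<in> orbit \<rho> x. \<rho> y \<in> B} = B \<inter> orbit \<rho> x"
      proof (intro equalityI subsetI)
        fix z assume z: "z \<in> B \<inter> orbit \<rho> x"
        obtain y where y: "z = \<rho> y" using r_perm by (metis permutes_surj surjD)
        then show "z \<in> \<rho> ` {y \<in> orbit \<rho> x. \<rho> y \<in> B}"
          using z by (intro image_eqI[of _ _ y]) (simp_all add: orb orbs)
      next
        fix z assume "z \<in> \<rho> ` {y \<in> orbit \<rho> x. \<rho> y \<in> B}"
        then obtain y where "z = \<rho> y" "y \<in> orbit \<rho> x" "\<rho> y \<in> B" by blast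
        then show "z \<in> B \<inter> orbit \<rho> x" by (simp add: orb orbs)
      qed
      moreover have "inj_on \<rho> X" for X using permutes_inj[OF r_perm] by (rule inj_on_subset) simp
      ultimately have "card {y \<in> orbit \<rho> x. \<rho> y \<in> B} = card (B \<inter> orbit \<rho> x)"
        by (metis card_image)
      then show ?thesis
        unfolding T' using odd_card_symd[of "B \<inter> orbit \<rho> x" "{y \<in> orbit \<rho> x. \<rho> y \<in> B}"] fO
        by simp
    qed
    ultimately show "T \<in> {T \<in> E. \<delta> T = {}}" by (auto simp: \<delta>_def)
  qed
  \<comment> \<open>Combines \<open>F2\<close>, \<open>V2\<close>, \<open>E1\<close> and
    \<open>VF\<close>. Together with the inclusion \<open>sub\<close>, the inequality gives
    exactness at the edges.\<close>
  have "card {T \<in> E. \<delta> T = {}} \<le> card (\<gamma> ` F)"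
  proof -
    define k where "k = card {T \<in> E. \<delta> T = {}}"
    have "k * card V \<le> k * (2 * card (\<delta> ` E))" using V2 by (rule mult_le_mono2)
    also have "\<dots> = 2 * card E" using E1 by (simp add: k_def)
    finally have "k * card V \<le> 2 * card E" .
    then have "k * card V * card F \<le> 2 * card E * card F" by (rule mult_le_mono1)
    moreover have "k * card V * card F = card E * (4 * k)"
      using VF by (metis mult.assoc mult.commute)
    ultimately have "card E * (4 * k) \<le> card E * (2 * card F)" by (simp only: mult_ac)
    moreover have "card E > 0" using cE by simp
    ultimately have "4 * k \<le> 2 * card F" using mult_le_cancel1 by blast
    then show ?thesis using F2 by (simp add: k_def)
  qed
  then have eq: "\<gamma> ` F = {T \<in> E. \<delta> T = {}}"
    using sub fin by (intro card_seteq) auto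
  \<comment> \<open>The set of all edges is a cycle because every vertex has evenly many
    darts.\<close>
  have "C \<in> E" by (auto simp: E_def invariant_sets_def oC)
  moreover have "\<delta> C = {}"
  proof -
    have "even (card (C \<inter> orbit \<rho> x))" if "x \<in> C" for x
      using ev[of x] orbC[OF that] CA that by (simp add: Int_absorb1 subset_iff)
    then show ?thesis by (auto simp: \<delta>_def)
  qed
  ultimately have "C \<in> \<gamma> ` F" unfolding eq by simp
  then obtain B where B: "B \<in> F" "\<gamma> B = C" by blast
  then have "\<alpha> x \<in> B \<longleftrightarrow> x \<notin> B" if "x \<in> C" for x using that by (auto simp: \<gamma>_def)
  then show ?thesis using B unfolding C_def[symmetric] F_def invariant_sets_def by blast
qed

text \<open>Membership in \<open>B\<close> is the colour of the face to the right of a dart.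
  \<open>\<alpha>\<close> passes to the other side of the edge, and \<open>\<rho> d\<close> lies on
  the same face as \<open>\<alpha> d\<close>, so both change the colour.\<close>

lemma two_colouring:
  assumes "spherical M" "\<And>d. d \<in> A \<Longrightarrow> even (card (orbit \<rho> d))"
  obtains B where "\<And>d. d \<in> A \<Longrightarrow> \<rho> d \<in> B \<longleftrightarrow> d \<notin> B" "\<And>d. d \<in> A \<Longrightarrow> \<alpha> d \<in> B \<longleftrightarrow> d \<notin> B"
proof -
  have "\<exists>B. (\<forall>x\<in>C. \<phi> x \<in> B \<longleftrightarrow> x \<in> B) \<and> (\<forall>x\<in>C. \<alpha> x \<in> B \<longleftrightarrow> x \<notin> B)" if "C \<in> components M" for C
  proof -
    obtain d where "d \<in> A" "C = component M d" using \<open>C \<in> components M\<close> by (auto simp: components_def)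
    then show ?thesis using component_two_colouring[of d] assms that by (simp add: spherical_def)
  qed
  then obtain b where b: "\<And>C x. C \<in> components M \<Longrightarrow> x \<in> C \<Longrightarrow> \<phi> x \<in> b C \<longleftrightarrow> x \<in> b C"
    "\<And>C x. C \<in> components M \<Longrightarrow> x \<in> C \<Longrightarrow> \<alpha> x \<in> b C \<longleftrightarrow> x \<notin> b C"
    by metis
  \<comment> \<open>The colourings of the components are chosen independently; each dart follows
    that of its own component.\<close>
  define B where "B = {x. x \<in> b (component M x)}"
  have c: "component M (\<alpha> x) = component M x" "component M (\<rho> x) = component M x" if "x \<in> A" for x
    using that by (auto intro!: component_eq component_step component_self)
  have ob: "\<alpha> x \<in> B \<longleftrightarrow> x \<notin> B" if x: "x \<in> A" for x
    using b(2)[of "component M x" x] x c component_self[of x M] by (auto simp: B_def components_def)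
  have "\<phi> x \<in> B \<longleftrightarrow> x \<in> B" if x: "x \<in> A" for x
    using b(1)[of "component M x" x] x c component_self[of x M]
    by (auto simp: B_def components_def face_step_def o_in)
  from this[of "\<alpha> _"] have "\<rho> x \<in> B \<longleftrightarrow> x \<notin> B" if "x \<in> A" for x
    using that by (simp add: face_step_def o_in o_simps ob)
  with ob that show ?thesis by blast
qed

end

section \<open>Replacing every vertex by a ring\<close>

text \<open>The crossing on the edge of a dart \<open>x\<close> at the ring around its vertex has four darts, in
  counterclockwise order: \<open>Out\<close> points away from the vertex along the edge, \<open>Next\<close> follows
  the ring towards the crossing of \<open>rot M x\<close>, \<open>Inn\<close> enters the ring, and \<open>Prev\<close> follows
  the ring backwards.\<close>

datatype quarter = Out | Next | Inn | Prev

lemma UNIV_quarter: "UNIV = {Out, Next, Inn, Prev}"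
  using quarter.exhaust by auto

fun turn :: "quarter \<Rightarrow> quarter" where
  "turn Out = Next" | "turn Next = Inn" | "turn Inn = Prev" | "turn Prev = Out"

lemma turn4: "turn (turn (turn (turn q))) = q"
  by (cases q) auto

text \<open>\<open>U\<close> consists of the darts along which the strand of the edge passes over the ring. Inside the
  ring, the strand of \<open>x \<in> U\<close> continues to that of \<open>rot M x\<close>. The injection \<open>c\<close> serves only
  to place the darts of the diagram in an arbitrary type.\<close>

locale ring_diagram = combinatorial_map M for M :: "('a, 'z) comb_map_scheme" +
  fixes U :: "'a set" and c :: "'a \<times> quarter \<Rightarrow> 'd" and n :: nat
  assumes spherical: "spherical M"
    and rot_U: "\<And>x. x \<in> A \<Longrightarrow> \<rho> x \<in> U \<longleftrightarrow> x \<notin> U"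
    and opp_U: "\<And>x. x \<in> A \<Longrightarrow> \<alpha> x \<in> U \<longleftrightarrow> x \<in> U"
    and face_step_neq: "\<And>x. x \<in> A \<Longrightarrow> \<rho> (\<alpha> x) \<noteq> x"
    and inj_c: "inj_on c (A \<times> UNIV)"
begin

abbreviation "\<rho>' \<equiv> inv \<rho>"

lemma inv_rot [simp]: "\<rho> (\<rho>' x) = x" "\<rho>' (\<rho> x) = x"
  using r_perm by (simp_all add: permutes_inverses)

lemma rot_neq: "x \<in> A \<Longrightarrow> \<rho> x \<noteq> x"
  using rot_U by metis

lemma inv_rot_in: "\<rho>' x \<in> A \<longleftrightarrow> x \<in> A"
  using r_in[of "\<rho>' x"] by simp

lemma inv_rot_U: "x \<in> A \<Longrightarrow> \<rho>' x \<in> U \<longleftrightarrow> x \<notin> U"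
  using rot_U[of "\<rho>' x"] inv_rot_in by simp

lemma inv_rot_neq: "x \<in> A \<Longrightarrow> \<rho>' x \<noteq> x"
  using inv_rot_U by metis

lemmas dart_simps [simp] = o_in r_in inv_rot_in o_simps(2) rot_U opp_U inv_rot_U

text \<open>The \<open>Inn\<close> clause pairs each dart in \<open>U\<close> with its successor
  around the vertex; this is an involution because \<open>\<rho>\<close> flips membership in
  \<open>U\<close>.\<close>

fun ring_opp :: "'a \<times> quarter \<Rightarrow> 'a \<times> quarter" where
  "ring_opp (x, Out) = (\<alpha> x, Out)"
| "ring_opp (x, Next) = (\<rho> x, Prev)"
| "ring_opp (x, Prev) = (\<rho>' x, Next)"
| "ring_opp (x, Inn) = (if x \<in> U then \<rho> x else \<rho>' x, Inn)"

definition dart :: "'d \<Rightarrow> 'a \<times> quarter" where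
  "dart = inv_into (A \<times> UNIV) c"

text \<open>The identity away from the placed darts, as \<open>permutes\<close> demands.\<close>

definition lift :: "('a \<times> quarter \<Rightarrow> 'a \<times> quarter) \<Rightarrow> 'd \<Rightarrow> 'd" where
  "lift f z = (if z \<in> c ` (A \<times> UNIV) then c (f (dart z)) else z)"

text \<open>\<open>over_end\<close> makes the strand of the edge (\<open>Out\<close> and
  \<open>Inn\<close>) pass over for \<open>x\<close> in \<open>U\<close>, and the ring
  (\<open>Next\<close> and \<open>Prev\<close>) otherwise.\<close>

definition D :: "'d link_diagram" where
  "D = \<lparr>darts = c ` (A \<times> UNIV), opp = lift ring_opp, rot = lift (\<lambda>(x, q). (x, turn q)),
     over_end = (\<lambda>z. let (x, q) = dart z in x \<in> U \<longleftrightarrow> q \<in> {Out, Inn}), circles = n\<rparr>"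

section \<open>The ring diagram as a combinatorial map\<close>

lemma c_eq: "x \<in> A \<Longrightarrow> y \<in> A \<Longrightarrow> c (x, q) = c (y, q') \<longleftrightarrow> x = y \<and> q = q'"
  using inj_c by (auto dest: inj_onD)

lemma dart_c: "x \<in> A \<Longrightarrow> dart (c (x, q)) = (x, q)"
  unfolding dart_def using inj_c by (intro inv_into_f_f) auto

lemma lift_c: "x \<in> A \<Longrightarrow> lift f (c (x, q)) = c (f (x, q))"
  by (auto simp: lift_def dart_c)

lemma darts_D: "darts D = c ` (A \<times> UNIV)"
  by (simp add: D_def)

lemma c_in [simp]: "x \<in> A \<Longrightarrow> c (x, q) \<in> darts D"
  by (simp add: darts_D)

lemma dartE:
  assumes "z \<in> darts D"
  obtains x q where "x \<in> A" "z = c (x, q)"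
  using assms by (auto simp: darts_D)

lemma rot_D [simp]: "x \<in> A \<Longrightarrow> rot D (c (x, q)) = c (x, turn q)"
  by (simp add: D_def lift_c)

lemma opp_D [simp]: "x \<in> A \<Longrightarrow> opp D (c (x, q)) = c (ring_opp (x, q))"
  by (simp add: D_def lift_c)

lemma over_end_D [simp]: "x \<in> A \<Longrightarrow> over_end D (c (x, q)) \<longleftrightarrow> (x \<in> U \<longleftrightarrow> q \<in> {Out, Inn})"
  by (simp add: D_def dart_c)

lemma circles_D [simp]: "circles D = n"
  by (simp add: D_def)

lemma finite_darts_D: "finite (darts D)"
proof -
  have "finite (UNIV :: quarter set)" by (simp add: UNIV_quarter)
  then show ?thesis by (simp add: darts_D finite_A)
qed

lemma opp_opp_D: "x \<in> A \<Longrightarrow> opp D (opp D (c (x, q))) = c (x, q)"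
  by (cases q) auto

lemma comb_map_D: "comb_map D"
proof -
  have "bij_betw (rot D) (darts D) (darts D)"
    by (rule bij_betwI[where g = "\<lambda>z. rot D (rot D (rot D z))"]) (auto elim!: dartE simp: turn4)
  then have "rot D permutes darts D"
    by (rule bij_imp_permutes) (simp add: D_def lift_def)
  moreover have "bij_betw (opp D) (darts D) (darts D)"
  proof (rule bij_betwI[where g = "opp D"])
    have "opp D (c (x, q)) \<in> darts D" if "x \<in> A" for x q
      using that by (cases q) auto
    then show "opp D \<in> darts D \<rightarrow> darts D" "opp D \<in> darts D \<rightarrow> darts D"
      by (auto elim!: dartE simp del: opp_D)
  qed (auto elim!: dartE simp: opp_opp_D simp del: opp_D)
  then have "opp D permutes darts D"
    by (rule bij_imp_permutes) (simp add: D_def lift_def)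
  moreover have "opp D (c (x, q)) \<noteq> c (x, q)" if "x \<in> A" for x q
    using that o_simps(1)[of x] rot_neq[of x] inv_rot_neq[of x] by (cases q) (auto simp: c_eq)
  ultimately show ?thesis
    using opp_opp_D finite_darts_D by (auto simp: comb_map_def elim!: dartE simp del: opp_D)
qed

sublocale D: combinatorial_map D
  by unfold_locales (rule comb_map_D)

lemma orbit_rot_D:
  assumes "x \<in> A"
  shows "orbit (rot D) (c (x, q)) = c ` ({x} \<times> UNIV)"
proof
  show "orbit (rot D) (c (x, q)) \<subseteq> c ` ({x} \<times> UNIV)"
    using assms by (intro orbit_subset_closed) auto
  have base: "c (x, turn q) \<in> orbit (rot D) (c (x, q))"
    using orbit.base[of "rot D" "c (x, q)"] assms by simp
  have step: "c (x, turn q') \<in> orbit (rot D) (c (x, q))"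
    if "c (x, q') \<in> orbit (rot D) (c (x, q))" for q'
    using orbit.step[OF that] assms by simp
  have "c (x, q') \<in> orbit (rot D) (c (x, q))" for q'
    using base step[OF base] step[OF step[OF base]] step[OF step[OF step[OF base]]]
    by (cases q; cases q') simp_all
  then show "c ` ({x} \<times> UNIV) \<subseteq> orbit (rot D) (c (x, q))" by blast
qed

lemma crossing_D: "x \<in> A \<Longrightarrow> crossing D (c (x, q)) = c ` ({x} \<times> UNIV)"
  by (simp add: crossing_def orbit_rot_D)

lemma crossing_eq:
  assumes "x \<in> A" "y \<in> A"
  shows "c ` ({x} \<times> UNIV) = c ` ({y} \<times> UNIV) \<longleftrightarrow> x = y"
proof
  assume "c ` ({x} \<times> UNIV) = c ` ({y} \<times> UNIV)"
  then have "c (x, Out) \<in> c ` ({y} \<times> UNIV)" by blast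
  then show "x = y" using assms by (auto simp: c_eq)
qed simp

lemma crossings_D: "crossings D = (\<lambda>x. c ` ({x} \<times> UNIV)) ` A"
proof -
  have "crossings D = (\<lambda>(x, q). crossing D (c (x, q))) ` (A \<times> UNIV)"
    by (simp add: crossings_def darts_D image_image case_prod_beta')
  also have "\<dots> = (\<lambda>(x, q). c ` ({x} \<times> UNIV)) ` (A \<times> (UNIV :: quarter set))"
    by (intro image_cong) (auto simp: crossing_D)
  also have "\<dots> = (\<lambda>x. c ` ({x} \<times> UNIV)) ` A" by force
  finally show ?thesis .
qed

lemma card_crossing:
  assumes "x \<in> A"
  shows "card (c ` ({x} \<times> UNIV)) = 4"
proof -
  have "inj_on c ({x} \<times> UNIV)" using assms by (intro inj_on_subset[OF inj_c]) auto
  moreover have "card (UNIV :: quarter set) = 4" by (simp add: UNIV_quarter)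
  ultimately show ?thesis by (simp add: card_image card_cartesian_product)
qed

text \<open>The quarters of a crossing are connected to each other, the \<open>Out\<close> edges
  follow \<open>\<alpha>\<close> and the \<open>Next\<close> edges follow \<open>\<rho>\<close>;
  conversely, no edge of \<open>D\<close> leaves a component of \<open>M\<close>.\<close>

lemma component_D:
  assumes x: "x \<in> A"
  shows "component D (c (x, q)) = c ` (component M x \<times> UNIV)"
proof
  have sub: "component M x \<subseteq> A" using component_subset x .
  have inv: "\<rho>' y \<in> component M x \<longleftrightarrow> y \<in> component M x" for y
    using component_iff(2)[OF x, of "\<rho>' y"] by simp
  show "component D (c (x, q)) \<subseteq> c ` (component M x \<times> UNIV)"
  proof
    fix z assume "z \<in> component D (c (x, q))"
    then show "z \<in> c ` (component M x \<times> UNIV)"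
    proof (induction rule: component_induct)
      case base show ?case using component_self[of x M] by simp
    next
      case (opp z)
      then obtain y q' where y: "y \<in> component M x" "z = c (y, q')" by auto
      then have "y \<in> A" using sub by blast
      moreover have "fst (ring_opp (y, q')) \<in> component M x"
        using y by (cases q') (simp_all add: component_iff[OF x] inv)
      ultimately show ?case unfolding y(2) by (simp add: mem_Times_iff)
    next
      case (rot z)
      then obtain y q' where y: "y \<in> component M x" "z = c (y, q')" by auto
      moreover from this have "y \<in> A" using sub by blast
      ultimately show ?case unfolding y(2) by simp
    qed
  qed
  have qq: "c (y, q'') \<in> component D (c (x, q))"
    if "y \<in> A" "c (y, q') \<in> component D (c (x, q))" for y q' q''
  proof -
    have "orbit (rot D) (c (y, q')) \<subseteq> component D (c (x, q))"
      using that(2) by (rule orbit_subset_closed) (simp add: D.component_iff x)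
    then show ?thesis using orbit_rot_D[OF that(1)] by blast
  qed
  have "\<forall>q'. c (y, q') \<in> component D (c (x, q))" if "y \<in> component M x" for y
    using that
  proof (induction rule: component_induct)
    case base show ?case using qq[OF x component_self] by (rule allI)
  next
    case (opp y)
    have "c (\<alpha> y, Out) \<in> component D (c (x, q))"
      using D.component_iff(1)[of "c (x, q)" "c (y, Out)"] x opp by simp
    then show ?case using qq[of "\<alpha> y" Out] opp(2) by simp
  next
    case (rot y)
    have "c (\<rho> y, Prev) \<in> component D (c (x, q))"
      using D.component_iff(1)[of "c (x, q)" "c (y, Next)"] x rot by simp
    then show ?case using qq[of "\<rho> y" Prev] rot(2) by simp
  qed
  then show "c ` (component M x \<times> UNIV) \<subseteq> component D (c (x, q))" by auto
qed

section \<open>Faces and Euler characteristic of the ring diagram\<close>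

abbreviation "f \<equiv> face_step D"

text \<open>\<open>Out\<close> and \<open>Next\<close> alternate along the outer faces,
  \<open>Inn\<close> and \<open>Prev\<close> along the faces inside a ring. There, an
  \<open>Inn\<close> dart at \<open>x\<close> in \<open>U\<close> borders a bigon, and the other
  \<open>Inn\<close> darts border the central region.\<close>

lemma face_D:
  assumes "x \<in> A"
  shows "f (c (x, Out)) = c (\<alpha> x, Next)" "f (c (x, Next)) = c (\<rho> x, Out)"
    "f (c (x, Prev)) = c (\<rho>' x, Inn)"
    "x \<in> U \<Longrightarrow> f (c (x, Inn)) = c (\<rho> x, Prev)" "x \<notin> U \<Longrightarrow> f (c (x, Inn)) = c (\<rho>' x, Prev)"
  using assms by (simp_all add: face_step_def)

lemma orbit_face_D_iff: "orbit f y = orbit f z \<longleftrightarrow> y \<in> orbit f z"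
  by (rule orbit_eq_iff[OF D.face_perm finite_darts_D])

lemma orbit_face_D_step: "orbit f (f z) = orbit f z"
  by (rule permutes_orbit_step[OF D.face_perm finite_darts_D])

text \<open>The \<open>Next\<close> dart at \<open>z\<close> is followed by the \<open>Out\<close>
  dart at \<open>\<rho> z\<close>, whence the condition on \<open>z\<close>.\<close>

lemma outer_face_subset:
  assumes "y \<in> A"
  shows "orbit f (c (y, Out))
    \<subseteq> c ` (orbit \<phi> y \<times> {Out}) \<union> c ` ({z \<in> A. \<rho> z \<in> orbit \<phi> y} \<times> {Next})"
proof (rule orbit_subset_closed)
  have s: "orbit \<phi> y \<subseteq> A" using permutes_orbit_subset[OF face_perm assms] .
  show "c (y, Out) \<in> c ` (orbit \<phi> y \<times> {Out}) \<union> c ` ({z \<in> A. \<rho> z \<in> orbit \<phi> y} \<times> {Next})"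
    using permutes_self_in_orbit[OF face_perm finite_A, of y] by blast
  fix z assume "z \<in> c ` (orbit \<phi> y \<times> {Out}) \<union> c ` ({z \<in> A. \<rho> z \<in> orbit \<phi> y} \<times> {Next})"
  then consider x where "x \<in> orbit \<phi> y" "z = c (x, Out)"
    | x where "x \<in> A" "\<rho> x \<in> orbit \<phi> y" "z = c (x, Next)" by auto
  then show "f z \<in> c ` (orbit \<phi> y \<times> {Out}) \<union> c ` ({z \<in> A. \<rho> z \<in> orbit \<phi> y} \<times> {Next})"
  proof cases
    case 1
    then have "x \<in> A" using s by auto
    moreover have "\<rho> (\<alpha> x) \<in> orbit \<phi> y" using orbit.step[OF 1(1)] by (simp add: face_step_def)
    ultimately show ?thesis by (simp add: 1 face_D)
  next
    case 2 then show ?thesis by (simp add: face_D)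
  qed
qed

text \<open>Two face steps lead from the \<open>Out\<close> dart at \<open>z\<close> to the one at
  \<open>\<phi> z\<close>, so the outer faces correspond to the faces of \<open>M\<close>.\<close>

lemma outer_faces:
  assumes "x \<in> A" "y \<in> A"
  shows "orbit f (c (x, Out)) = orbit f (c (y, Out)) \<longleftrightarrow> orbit \<phi> x = orbit \<phi> y"
  unfolding orbit_face_D_iff orbit_eq_iff[OF face_perm finite_A]
proof
  assume "c (x, Out) \<in> orbit f (c (y, Out))"
  then have "c (x, Out) \<in> c ` (orbit \<phi> y \<times> {Out}) \<union> c ` ({z \<in> A. \<rho> z \<in> orbit \<phi> y} \<times> {Next})"
    using outer_face_subset[OF assms(2)] by blast
  then show "x \<in> orbit \<phi> y"
    using permutes_orbit_subset[OF face_perm assms(2)] assms(1) by (auto simp: c_eq subset_iff)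
next
  have *: "f (f (c (z, Out))) = c (\<phi> z, Out)" if "z \<in> A" for z
    using that by (simp add: face_D) (simp add: face_step_def)
  assume "x \<in> orbit \<phi> y"
  then show "c (x, Out) \<in> orbit f (c (y, Out))"
  proof induction
    case base
    show ?case using orbit.step[OF orbit.base, of f "c (y, Out)"] unfolding *[OF assms(2)] .
  next
    case (step z)
    then have "z \<in> A" using permutes_orbit_subset[OF face_perm assms(2)] by blast
    then show ?case using orbit.step[OF orbit.step[OF step(2)]] unfolding *[OF \<open>z \<in> A\<close>] by simp
  qed
qed

text \<open>The walk from the \<open>Inn\<close> dart at \<open>y\<close> closes up after two steps
  and meets no other \<open>Inn\<close> dart.\<close>

lemma bigons:
  assumes "x \<in> A" "y \<in> A" "y \<in> U"
  shows "orbit f (c (x, Inn)) = orbit f (c (y, Inn)) \<longleftrightarrow> x = y"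
proof
  assume "orbit f (c (x, Inn)) = orbit f (c (y, Inn))"
  then have "c (x, Inn) \<in> orbit f (c (y, Inn))" by (simp add: orbit_face_D_iff)
  also have "orbit f (c (y, Inn)) \<subseteq> {c (y, Inn), c (\<rho> y, Prev)}"
    using assms by (intro orbit_subset_closed) (auto simp: face_D)
  finally show "x = y" using assms by (auto simp: c_eq)
qed simp

text \<open>The walk goes clockwise around the vertex and visits each of its darts, at
  \<open>Prev\<close> for those in \<open>U\<close> and at \<open>Inn\<close> for the others. So
  each vertex has exactly one central face.\<close>

lemma central_faces:
  assumes "x \<in> A" "y \<in> A" "x \<notin> U" "y \<notin> U"
  shows "orbit f (c (x, Inn)) = orbit f (c (y, Inn)) \<longleftrightarrow> orbit \<rho> x = orbit \<rho> y"
proof -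
  have perm: "permutation \<rho>" using r_perm finite_A by (auto simp: permutation_permutes)
  have s: "orbit \<rho>' y \<subseteq> A" using permutes_orbit_subset[OF permutes_inv[OF r_perm] assms(2)] .
  let ?B = "c ` ((orbit \<rho>' y - U) \<times> {Inn}) \<union> c ` ((orbit \<rho>' y \<inter> U) \<times> {Prev})"
  have "orbit f (c (y, Inn)) \<subseteq> ?B"
  proof (rule orbit_subset_closed)
    show "c (y, Inn) \<in> ?B"
      using permutes_self_in_orbit[OF permutes_inv[OF r_perm] finite_A, of y] assms by blast
    fix z assume "z \<in> ?B"
    then obtain w where w: "w \<in> orbit \<rho>' y" and "w \<notin> U \<and> z = c (w, Inn) \<or> w \<in> U \<and> z = c (w, Prev)"
      by auto
    moreover from w s have "w \<in> A" by blast
    ultimately show "f z \<in> ?B" using orbit.step[OF w] by (auto simp: face_D)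
  qed
  moreover have "(w \<notin> U \<longrightarrow> c (w, Inn) \<in> orbit f (c (y, Inn))) \<and>
      (w \<in> U \<longrightarrow> c (w, Prev) \<in> orbit f (c (y, Inn)))" if "w \<in> orbit \<rho>' y" for w
    using that
  proof induction
    case base
    show ?case using assms orbit.base[of f "c (y, Inn)"] by (simp add: face_D)
  next
    case (step w)
    then have "w \<in> A" using s by blast
    then show ?case using step orbit.step[where f = f and y = "c (w, Inn)"]
        orbit.step[where f = f and y = "c (w, Prev)"]
      by (auto simp: face_D)
  qed
  ultimately have "c (x, Inn) \<in> orbit f (c (y, Inn)) \<longleftrightarrow> x \<in> orbit \<rho>' y"
    using assms s by (auto simp: c_eq subset_iff)
  then show ?thesis
    by (simp add: orbit_face_D_iff orbit_eq_iff[OF r_perm finite_A] orbit_inv_eq[OF perm])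
qed

lemma outer_not_inner:
  assumes "x \<in> A" "y \<in> A"
  shows "orbit f (c (x, Inn)) \<noteq> orbit f (c (y, Out))"
proof
  assume "orbit f (c (x, Inn)) = orbit f (c (y, Out))"
  then have "c (x, Inn) \<in> orbit f (c (y, Out))" by (simp add: orbit_face_D_iff)
  then have "c (x, Inn) \<in> c ` (orbit \<phi> y \<times> {Out}) \<union> c ` ({z \<in> A. \<rho> z \<in> orbit \<phi> y} \<times> {Next})"
    using outer_face_subset[OF assms(2)] by blast
  then show False
    using permutes_orbit_subset[OF face_perm assms(2)] assms(1) by (auto simp: c_eq subset_iff)
qed

text \<open>If the component has V vertices, E edges and F faces in \<open>M\<close>, then in
  \<open>D\<close> it has 2E crossings, 4E edges, and F outer faces, E bigons and V central faces.
  Hence the Euler characteristic is unchanged.\<close>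

lemma euler_D:
  fixes q
  assumes x0: "x0 \<in> A"
  defines "K \<equiv> component M x0" and "C \<equiv> component D (c (x0, q))"
  shows "int (card (orbit (rot D) ` C)) - int (card (orbit (opp D) ` C)) + int (card (orbit f ` C)) = 2"
proof -
  have C: "C = c ` (K \<times> UNIV)" unfolding C_def K_def by (rule component_D[OF x0])
  have KA: "K \<subseteq> A" unfolding K_def by (rule component_subset[OF x0])
  have fK: "finite K" using finite_A KA by (rule rev_finite_subset)
  have K: "\<alpha> x \<in> K \<longleftrightarrow> x \<in> K" "\<rho> x \<in> K \<longleftrightarrow> x \<in> K" "\<rho>' x \<in> K \<longleftrightarrow> x \<in> K" for x
    unfolding K_def using component_iff[OF x0, of x] component_iff(2)[OF x0, of "\<rho>' x"] by simp_all
  have inA: "x \<in> A" if "x \<in> K" for x using that KA by blast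
  have "K \<in> components M" using x0 by (auto simp: K_def components_def)
  then have euler: "int (card (orbit \<rho> ` K)) - int (card (orbit \<alpha> ` K)) + int (card (orbit \<phi> ` K)) = 2"
    using spherical by (simp add: spherical_def)
  have E: "2 * card (orbit \<alpha> ` K) = card K" using KA K by (intro card_edges) auto
  have "orbit (rot D) ` C = (\<lambda>x. c ` ({x} \<times> UNIV)) ` K"
    using inA by (force simp: C image_iff orbit_rot_D)
  moreover have "inj_on (\<lambda>x. c ` ({x} \<times> UNIV)) K"
    using crossing_eq inA by (intro inj_onI) blast
  ultimately have V': "card (orbit (rot D) ` C) = card K" by (simp add: card_image)
  have "inj_on c (K \<times> UNIV)" using KA by (intro inj_on_subset[OF inj_c]) auto
  then have "card C = 4 * card K"
    by (simp add: C card_image card_cartesian_product UNIV_quarter)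
  moreover have "2 * card (orbit (opp D) ` C) = card C"
  proof (rule D.card_edges)
    show "C \<subseteq> darts D" unfolding C_def using x0 by (intro D.component_subset) simp
    show "opp D z \<in> C" if "z \<in> C" for z using that x0 D.component_iff[of "c (x0, q)"] C_def by simp
  qed
  ultimately have E': "card (orbit (opp D) ` C) = 2 * card K" by simp
  let ?O = "(\<lambda>x. orbit f (c (x, Out)))" and ?I = "(\<lambda>x. orbit f (c (x, Inn)))"
  \<comment> \<open>Every face contains an \<open>Out\<close> or \<open>Inn\<close> dart, because
    these follow \<open>Next\<close> and \<open>Prev\<close>.\<close>
  have "orbit f ` C = ?O ` K \<union> (?I ` (K \<inter> U) \<union> ?I ` (K - U))"
  proof (intro equalityI subsetI)
    fix z assume "z \<in> orbit f ` C"
    then obtain x q where x: "x \<in> K" "z = orbit f (c (x, q))" by (auto simp: C)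
    have "z \<in> ?O ` K \<union> ?I ` K"
    proof (cases q)
      case Next
      then have "z = ?O (\<rho> x)" using orbit_face_D_step[of "c (x, q)"] x inA by (simp add: face_D)
      then show ?thesis using x(1) K(2) by blast
    next
      case Prev
      then have "z = ?I (\<rho>' x)" using orbit_face_D_step[of "c (x, q)"] x inA by (simp add: face_D)
      then show ?thesis using x(1) K(3) by blast
    qed (use x in simp_all)
    then show "z \<in> ?O ` K \<union> (?I ` (K \<inter> U) \<union> ?I ` (K - U))" by blast
  next
    fix z assume "z \<in> ?O ` K \<union> (?I ` (K \<inter> U) \<union> ?I ` (K - U))"
    then obtain x q where "x \<in> K" "z = orbit f (c (x, q))" by blast
    then show "z \<in> orbit f ` C" unfolding C by simp
  qed
  moreover have "card (?O ` K \<union> (?I ` (K \<inter> U) \<union> ?I ` (K - U)))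
      = card (?O ` K) + (card (?I ` (K \<inter> U)) + card (?I ` (K - U)))"
  proof (subst card_Un_disjoint)
    show "?O ` K \<inter> (?I ` (K \<inter> U) \<union> ?I ` (K - U)) = {}"
    proof -
      have "?O x \<noteq> ?I y" if "x \<in> K" "y \<in> K" for x y
        using outer_not_inner[OF inA inA, OF that(2,1)] by (rule not_sym)
      then show ?thesis by blast
    qed
    have "?I x \<noteq> ?I y" if "x \<in> K \<inter> U" "y \<in> K - U" for x y
      using bigons[of y x] that inA by auto
    then have "?I ` (K \<inter> U) \<inter> ?I ` (K - U) = {}" by blast
    then have "card (?I ` (K \<inter> U) \<union> ?I ` (K - U)) = card (?I ` (K \<inter> U)) + card (?I ` (K - U))"
      using fK by (intro card_Un_disjoint) auto
    then show "card (?O ` K) + card (?I ` (K \<inter> U) \<union> ?I ` (K - U))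
      = card (?O ` K) + (card (?I ` (K \<inter> U)) + card (?I ` (K - U)))" by simp
  qed (use fK in auto)
  moreover have "card (?O ` K) = card (orbit \<phi> ` K)"
    using inA by (intro card_image_cong_kernel outer_faces) auto
  moreover have "card (?I ` (K \<inter> U)) = card (K \<inter> U)"
    using bigons inA by (intro card_image inj_onI) auto
  moreover have "card (?I ` (K - U)) = card (orbit \<rho> ` (K - U))"
    using inA by (intro card_image_cong_kernel central_faces) auto
  \<comment> \<open>Consecutive darts differ in membership in \<open>U\<close>, so each vertex has a
    dart outside \<open>U\<close>.\<close>
  moreover have "orbit \<rho> ` (K - U) = orbit \<rho> ` K"
  proof (intro equalityI subsetI)
    fix z assume "z \<in> orbit \<rho> ` K"
    then obtain x where x: "x \<in> K" "z = orbit \<rho> x" by blast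
    then have "z = orbit \<rho> (\<rho> x)" using permutes_orbit_step[OF r_perm finite_A] by simp
    then show "z \<in> orbit \<rho> ` (K - U)" using x K rot_U[OF inA[OF x(1)]] by blast
  qed auto
  moreover have "card (K \<inter> U) = card (K - U)"
  proof (rule bij_betw_same_card)
    show "bij_betw \<rho> (K \<inter> U) (K - U)"
      by (rule bij_betwI[where g = \<rho>']) (auto simp: K inA)
  qed
  moreover have "card K = card (K \<inter> U) + card (K - U)"
    using fK by (metis card_Int_Diff)
  ultimately have "card (orbit f ` C) = card (orbit \<phi> ` K) + (card (K \<inter> U) + card (orbit \<rho> ` K))"
    "card K = 2 * card (K \<inter> U)" by simp_all
  then show ?thesis using euler E V' E' by linarith
qed

lemma link_diagram_D: "link_diagram D"
proof -
  have "spherical D"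
    unfolding spherical_def components_def using euler_D by (auto elim!: dartE)
  moreover have "over_end D (c (x, turn q)) \<longleftrightarrow> \<not> over_end D (c (x, q))" if "x \<in> A" for x q
    using that by (cases q) auto
  ultimately show ?thesis
    unfolding link_diagram_def using comb_map_D
    by (auto elim!: dartE simp: orbit_rot_D card_crossing simp del: over_end_D)
qed

end

section \<open>The alternating decomposition graph\<close>

text \<open>The inverse vertex map undoes \<open>f\<close> only on \<open>verts G\<close>, hence the
  condition on the ends of edges.\<close>

lemma isomorphic_sym:
  assumes "isomorphic G H" and sub: "\<And>e. e \<in> edges G \<Longrightarrow> set_mset (ends G e) \<subseteq> verts G"
  shows "isomorphic H G"
proof -
  obtain f g where f: "bij_betw f (verts G) (verts H)" and g: "bij_betw g (edges G) (edges H)"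
    and fg: "\<And>e. e \<in> edges G \<Longrightarrow> ends H (g e) = image_mset f (ends G e)"
    using assms(1) unfolding isomorphic_def by blast
  let ?f = "inv_into (verts G) f" and ?g = "inv_into (edges G) g"
  have "ends G (?g e) = image_mset ?f (ends H e)" if "e \<in> edges H" for e
  proof -
    have "e \<in> g ` edges G" using that by (simp add: bij_betw_imp_surj_on[OF g])
    then obtain e' where e': "e' \<in> edges G" "e = g e'" by blast
    have "image_mset ?f (ends H e) = image_mset (\<lambda>v. ?f (f v)) (ends G e')"
      using fg[OF e'(1)] by (simp add: e'(2) multiset.map_comp comp_def)
    also have "\<dots> = image_mset (\<lambda>v. v) (ends G e')"
      using sub[OF e'(1)] by (intro image_mset_cong bij_betw_inv_into_left[OF f]) blast
    finally show ?thesis by (simp add: e'(2) bij_betw_inv_into_left[OF g e'(1)])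
  qed
  then show ?thesis
    unfolding isomorphic_def
    by (intro exI[of _ ?f] exI[of _ ?g]) (simp add: bij_betw_inv_into[OF f] bij_betw_inv_into[OF g])
qed

section \<open>Marked points and curves of the ring diagram\<close>

context ring_diagram
begin

text \<open>Membership in \<open>U\<close> is constant along the edges of \<open>M\<close> but
  changes between neighbours on a ring, so all ring segments and inner arcs are alternating.\<close>

lemma nonalternating_D: "nonalternating D = c ` (A \<times> {Out})"
proof -
  have *: "c (x, q) \<in> nonalternating D \<longleftrightarrow> q = Out" if "x \<in> A" for x q
    using that by (cases q) (auto simp: nonalternating_def)
  have "z \<in> c ` (A \<times> {Out})" if z: "z \<in> nonalternating D" for z
  proof -
    from z have "z \<in> darts D" by (simp add: nonalternating_def)
    then obtain x q where "x \<in> A" "z = c (x, q)" by (rule dartE)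
    then show ?thesis using z * by blast
  qed
  then show ?thesis using * by blast
qed

text \<open>Along an outer face, consecutive edges of \<open>M\<close> are separated by one ring
  segment, so the next marked dart is two steps away and the arc runs parallel to that
  segment.\<close>

lemma face_arcs_D: "face_arcs D = (\<lambda>y. (c (y, Out), c (\<rho> y, Out))) ` A"
proof (intro equalityI subsetI)
  have f2: "(f ^^ 2) (c (x, Out)) = c (\<rho> (\<alpha> x), Out)" if "x \<in> A" for x
    using that by (simp add: numeral_2_eq_2 face_D)
  have f1: "(f ^^ 1) (c (x, Out)) \<notin> nonalternating D" if "x \<in> A" for x
    using that by (auto simp: face_D nonalternating_D c_eq)
  {
    fix z assume "z \<in> face_arcs D"
    then obtain d d' k where z: "z = (opp D d, d')" "d \<in> nonalternating D" "d' \<in> nonalternating D"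
      "k > 0" "d' = (f ^^ k) d" and k: "\<And>m. 0 < m \<Longrightarrow> m < k \<Longrightarrow> (f ^^ m) d \<notin> nonalternating D"
      by (auto simp: face_arcs_def)
    then obtain x where x: "x \<in> A" "d = c (x, Out)" by (auto simp: nonalternating_D)
    have "k \<noteq> 1" using f1 x z by blast
    moreover have "\<not> 2 < k" using k[of 2] x by (auto simp: f2 nonalternating_D)
    ultimately have "k = 2" using z(4) by linarith
    then have "z = (c (\<alpha> x, Out), c (\<rho> (\<alpha> x), Out))" using x z by (simp add: f2)
    then show "z \<in> (\<lambda>y. (c (y, Out), c (\<rho> y, Out))) ` A" using x by simp
  next
    fix z assume "z \<in> (\<lambda>y. (c (y, Out), c (\<rho> y, Out))) ` A"
    then obtain y where y: "y \<in> A" and z: "z = (c (y, Out), c (\<rho> y, Out))" by blast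
    define d where "d = c (\<alpha> y, Out)"
    have *: "z = (opp D d, c (\<rho> y, Out))" "d \<in> nonalternating D" "c (\<rho> y, Out) \<in> nonalternating D"
      using y by (auto simp: z d_def nonalternating_D)
    \<comment> \<open>Here \<open>face_step_neq\<close> enters: the next marked point must not be on
      the same edge, or there would be no arc.\<close>
    have "c (\<rho> y, Out) \<notin> {d, opp D d}"
      using face_step_neq[of "\<alpha> y"] rot_neq[of y] y by (auto simp: d_def c_eq)
    moreover have "c (\<rho> y, Out) = (f ^^ 2) d" using y by (simp add: d_def f2)
    moreover have "\<forall>m. 0 < m \<and> m < 2 \<longrightarrow> (f ^^ m) d \<notin> nonalternating D"
    proof (intro allI impI)
      fix m :: nat assume "0 < m \<and> m < 2"
      then have "m = 1" by linarith
      then show "(f ^^ m) d \<notin> nonalternating D" using f1[of "\<alpha> y"] y by (simp add: d_def)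
    qed
    ultimately show "z \<in> face_arcs D"
      unfolding face_arcs_def using * zero_less_numeral by blast
  }
qed

text \<open>The arcs join each marked point to the next one around its ring, so the curve closes up
  after one turn around the vertex.\<close>

lemma curve_D:
  assumes "y \<in> A"
  shows "curve D (c (y, Out)) = c ` (orbit \<rho> y \<times> {Out})"
proof
  have s: "orbit \<rho> y \<subseteq> A" using permutes_orbit_subset[OF r_perm assms] .
  show "curve D (c (y, Out)) \<subseteq> c ` (orbit \<rho> y \<times> {Out})"
  proof
    fix z assume "z \<in> curve D (c (y, Out))"
    then have "(c (y, Out), z) \<in> (face_arcs D \<union> (face_arcs D)\<inverse>)\<^sup>*" by (simp add: curve_def)
    then show "z \<in> c ` (orbit \<rho> y \<times> {Out})"
    proof induction
      case base
      show ?case using permutes_self_in_orbit[OF r_perm finite_A, of y] by simp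
    next
      case (step z z')
      then obtain x where x: "x \<in> orbit \<rho> y" "z = c (x, Out)" by auto
      have xA: "x \<in> A" using x s by blast
      from step(2) consider w where "w \<in> A" "z = c (w, Out)" "z' = c (\<rho> w, Out)"
        | w where "w \<in> A" "z' = c (w, Out)" "z = c (\<rho> w, Out)"
        by (auto simp: face_arcs_D)
      then show ?case
      proof cases
        case 1
        then have "w = x" using x xA by (simp add: c_eq)
        then show ?thesis using 1 x orbit.step[of x \<rho> y] by simp
      next
        case 2
        then have "\<rho> w = x" using x xA by (simp add: c_eq)
        then have "orbit \<rho> w = orbit \<rho> y"
          using x(1) permutes_orbit_step[OF r_perm finite_A, of w]
          by (simp add: orbit_eq_iff[OF r_perm finite_A, symmetric])
        then show ?thesis using 2 by (simp add: orbit_eq_iff[OF r_perm finite_A])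
      qed
    qed
  qed
  have "(c (y, Out), c (x, Out)) \<in> (face_arcs D)\<^sup>*" if "x \<in> orbit \<rho> y" for x
    using that
  proof induction
    case base show ?case using assms by (auto simp: face_arcs_D)
  next
    case (step x)
    then have "(c (x, Out), c (\<rho> x, Out)) \<in> face_arcs D" using s by (auto simp: face_arcs_D)
    with step(2) show ?case by (rule rtrancl_into_rtrancl)
  qed
  moreover have "(face_arcs D)\<^sup>* \<subseteq> (face_arcs D \<union> (face_arcs D)\<inverse>)\<^sup>*" by (rule rtrancl_mono) blast
  ultimately show "c ` (orbit \<rho> y \<times> {Out}) \<subseteq> curve D (c (y, Out))"
    unfolding curve_def by auto
qed

text \<open>Every component with crossings contains an \<open>Out\<close> dart, so no vertex of the
  form \<open>Alternating\<close> arises.\<close>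

lemma verts_adg_D:
  "verts (adg D) = (\<lambda>x. Curve (c ` (orbit \<rho> x \<times> {Out}))) ` A \<union> Circle ` {..<n}"
proof -
  have "{Curve (curve D d) | d. d \<in> nonalternating D} = (\<lambda>x. Curve (c ` (orbit \<rho> x \<times> {Out}))) ` A"
  proof -
    have "{Curve (curve D d) | d. d \<in> nonalternating D} = (\<lambda>x. Curve (curve D (c (x, Out)))) ` A"
      by (auto simp: nonalternating_D)
    also have "\<dots> = (\<lambda>x. Curve (c ` (orbit \<rho> x \<times> {Out}))) ` A"
      by (intro image_cong) (simp_all add: curve_D)
    finally show ?thesis .
  qed
  moreover have "C \<inter> nonalternating D \<noteq> {}" if C: "C \<in> components D" for C
  proof -
    obtain x q where x: "x \<in> A" "C = c ` (component M x \<times> UNIV)"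
      using C component_D by (fastforce simp: components_def elim!: dartE)
    have "c (x, Out) \<in> C \<inter> nonalternating D"
      using x component_self[of x M] by (simp add: nonalternating_D)
    then show ?thesis by blast
  qed
  ultimately show ?thesis by (auto simp: adg_def)
qed

lemma edges_adg_D: "edges (adg D) = (\<lambda>x. {c (x, Out), c (\<alpha> x, Out)}) ` A"
proof -
  have "edges (adg D) = (\<lambda>x. {c (x, Out), opp D (c (x, Out))}) ` A"
    by (auto simp: adg_def nonalternating_D)
  then show ?thesis by simp
qed

lemma ends_adg_D:
  assumes "x \<in> A"
  shows "ends (adg D) {c (x, Out), c (\<alpha> x, Out)}
    = {#Curve (c ` (orbit \<rho> x \<times> {Out})), Curve (c ` (orbit \<rho> (\<alpha> x) \<times> {Out}))#}"
proof -
  have "c (x, Out) \<noteq> c (\<alpha> x, Out)" using assms o_simps(1)[OF assms] by (simp add: c_eq)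
  then show ?thesis using assms by (simp add: adg_def curve_D)
qed

end

text \<open>A vertex with darts corresponds to the curve around its ring; the isolated vertices,
  \<open>n\<close> in number, are matched with the circles by an enumeration
  \<open>h\<close>.\<close>

lemma isomorphic_adg_ring_diagram:
  assumes "ring_diagram M U c" and drawing: "spherical_drawing G base M"
    and G: "finite_multigraph G" and n: "n = card {v \<in> verts G. \<forall>d\<in>darts M. base d \<noteq> v}"
  shows "isomorphic (adg (ring_diagram.D M U c n)) G"
proof -
  interpret ring_diagram M U c n by fact
  have A: "A = edges G \<times> UNIV"
    and opp: "\<And>e b. e \<in> edges G \<Longrightarrow> \<alpha> (e, b) = (e, \<not> b)"
    and ends: "\<And>e. e \<in> edges G \<Longrightarrow> ends G e = {#base (e, False), base (e, True)#}"
    and orb: "\<And>d. d \<in> A \<Longrightarrow> orbit \<rho> d = {d' \<in> A. base d' = base d}"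
    using drawing unfolding spherical_drawing_def by blast+
  have sub: "set_mset (ends G e) \<subseteq> verts G" if "e \<in> edges G" for e
    using G that by (simp add: finite_multigraph_def)
  have base: "base d \<in> verts G" if "d \<in> A" for d
  proof -
    obtain e b where "d = (e, b)" "e \<in> edges G" using \<open>d \<in> A\<close> unfolding A by auto
    then show ?thesis using sub[of e] ends[of e] by (cases b) auto
  qed
  define I where "I = {v \<in> verts G. \<forall>d\<in>A. base d \<noteq> v}"
  have "finite I" using G by (simp add: I_def finite_multigraph_def)
  then obtain h where h: "bij_betw h I {..<n}"
    using n ex_bij_betw_finite_nat unfolding I_def atLeast0LessThan by blast
  define F where "F = (\<lambda>v. if v \<in> I then Circle (h v) else Curve (c ` ({d \<in> A. base d = v} \<times> {Out})))"
  define g where "g = (\<lambda>e. {c ((e, False), Out), c ((e, True), Out)})"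
  have F_base: "F (base d) = Curve (c ` (orbit \<rho> d \<times> {Out}))" if "d \<in> A" for d
    using that by (auto simp: F_def I_def orb)
  have verts_G: "verts G = I \<union> base ` A" using base by (auto simp: I_def)
  have "bij_betw F (verts G) (verts (adg D))"
    unfolding bij_betw_def
  proof
    show "F ` verts G = verts (adg D)"
    proof -
      have "F ` I = Circle ` {..<n}"
        using h by (auto simp: F_def bij_betw_def image_iff)
      moreover have "F ` base ` A = (\<lambda>x. Curve (c ` (orbit \<rho> x \<times> {Out}))) ` A"
        unfolding image_image by (intro image_cong) (simp_all add: F_base)
      ultimately show ?thesis unfolding verts_G verts_adg_D image_Un by blast
    qed
    show "inj_on F (verts G)"
    proof (rule inj_onI)
      fix v w assume v: "v \<in> verts G" and w: "w \<in> verts G" and eq: "F v = F w"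
      show "v = w"
      proof (cases "v \<in> I")
        case True
        then have "w \<in> I" using eq by (auto simp: F_def split: if_splits)
        then show ?thesis using True eq h by (auto simp: F_def bij_betw_def dest: inj_onD)
      next
        case False
        then obtain d where d: "d \<in> A" "base d = v" using v verts_G by auto
        have "w \<notin> I" using False eq by (auto simp: F_def split: if_splits)
        then have "c ` ({d \<in> A. base d = v} \<times> {Out}) = c ` ({d \<in> A. base d = w} \<times> {Out})"
          using False eq by (simp add: F_def)
        then have "c (d, Out) \<in> c ` ({d \<in> A. base d = w} \<times> {Out})" using d by blast
        then show ?thesis using d by (auto simp: c_eq)
      qed
    qed
  qed
  moreover have "bij_betw g (edges G) (edges (adg D))"
    unfolding bij_betw_def
  proof
    show "inj_on g (edges G)"
    proof (rule inj_onI)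
      fix e e' assume e: "e \<in> edges G" "e' \<in> edges G" "g e = g e'"
      then have "c ((e, False), Out) \<in> g e'" by (auto simp: g_def)
      then show "e = e'" using e(1,2) by (auto simp: g_def c_eq A)
    qed
    have *: "{c ((e, b), Out), c (\<alpha> (e, b), Out)} = g e" if "e \<in> edges G" for e b
      using opp[OF that] by (cases b) (auto simp: g_def)
    show "g ` edges G = edges (adg D)"
      unfolding edges_adg_D
    proof (intro equalityI subsetI)
      fix z assume "z \<in> g ` edges G"
      then obtain e where "e \<in> edges G" "z = g e" by blast
      then show "z \<in> (\<lambda>x. {c (x, Out), c (\<alpha> x, Out)}) ` A"
        using *[of e False] by (intro image_eqI[of _ _ "(e, False)"]) (simp_all add: A)
    next
      fix z assume "z \<in> (\<lambda>x. {c (x, Out), c (\<alpha> x, Out)}) ` A"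
      then obtain e b where "e \<in> edges G" "z = {c ((e, b), Out), c (\<alpha> (e, b), Out)}"
        unfolding A by blast
      then show "z \<in> g ` edges G" using * by blast
    qed
  qed
  moreover have "ends (adg D) (g e) = image_mset F (ends G e)" if e: "e \<in> edges G" for e
    using ends_adg_D[of "(e, False)"] e
    by (simp add: g_def opp ends A F_base)
  ultimately have "isomorphic G (adg D)" unfolding isomorphic_def by blast
  then show ?thesis using sub by (rule isomorphic_sym)
qed

section \<open>Adequacy\<close>

text \<open>Saturation under \<open>R'\<close> maps the classes of \<open>R\<close> onto those of
  \<open>R'\<close> and identifies the distinct classes of \<open>a\<close> and
  \<open>b\<close>.\<close>

lemma card_classes_less:
  assumes fin: "finite X" and sub: "R \<subseteq> R'\<^sup>*" and sym: "sym R" "sym R'"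
    and a: "a \<in> X" "b \<in> X" "(a, b) \<in> R'\<^sup>*" "(a, b) \<notin> R\<^sup>*"
  shows "card ((\<lambda>x. R'\<^sup>* `` {x}) ` X) < card ((\<lambda>x. R\<^sup>* `` {x}) ` X)"
proof -
  let ?C = "(\<lambda>x. R\<^sup>* `` {x}) ` X"
  have "R\<^sup>* \<subseteq> R'\<^sup>*" using sub by (rule rtrancl_subset_rtrancl)
  then have coarser: "R'\<^sup>* `` (R\<^sup>* `` {x}) = R'\<^sup>* `` {x}" for x
    by (blast intro: rtrancl_trans)
  have image: "(\<lambda>x. R'\<^sup>* `` {x}) ` X = (\<lambda>K. R'\<^sup>* `` K) ` ?C"
    by (simp add: image_image coarser)
  have class_eq: "Q\<^sup>* `` {a} = Q\<^sup>* `` {b} \<longleftrightarrow> (a, b) \<in> Q\<^sup>*" if "sym Q" for Q :: "('a \<times> 'a) set"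
  proof
    show "(a, b) \<in> Q\<^sup>*" if "Q\<^sup>* `` {a} = Q\<^sup>* `` {b}" using that by blast
    assume ab: "(a, b) \<in> Q\<^sup>*"
    then have "(b, a) \<in> Q\<^sup>*" using sym_rtrancl[OF \<open>sym Q\<close>] by (rule symD[rotated])
    then show "Q\<^sup>* `` {a} = Q\<^sup>* `` {b}" using ab by (blast intro: rtrancl_trans)
  qed
  have "\<not> inj_on (\<lambda>K. R'\<^sup>* `` K) ?C"
  proof
    assume "inj_on (\<lambda>K. R'\<^sup>* `` K) ?C"
    moreover have "R'\<^sup>* `` (R\<^sup>* `` {a}) = R'\<^sup>* `` (R\<^sup>* `` {b})"
      unfolding coarser using class_eq[OF sym(2)] a(3) by simp
    ultimately have "R\<^sup>* `` {a} = R\<^sup>* `` {b}" using a(1,2) by (auto dest: inj_onD)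
    then show False using class_eq[OF sym(1)] a(4) by simp
  qed
  then have "card ((\<lambda>K. R'\<^sup>* `` K) ` ?C) \<noteq> card ?C"
    using fin eq_card_imp_inj_on by blast
  moreover have "card ((\<lambda>K. R'\<^sup>* `` K) ` ?C) \<le> card ?C"
    using fin by (intro card_image_le) simp
  ultimately show ?thesis unfolding image by linarith
qed

text \<open>A cycle stays connected when the step out of \<open>x\<close> is removed: the rest of it
  leads from \<open>p x\<close> back to \<open>x\<close>.\<close>

lemma cycle_avoiding_first_step:
  assumes "p permutes A" "finite A" "x \<in> A"
  shows "(p x, x) \<in> {(y, p y) | y. y \<in> A \<and> y \<noteq> x}\<^sup>*" (is "_ \<in> ?R\<^sup>*")
proof -
  have "y \<in> A \<and> ((p x, y) \<in> ?R\<^sup>* \<or> (p x, x) \<in> ?R\<^sup>*)" if "y \<in> orbit p x" for y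
    using that
  proof induction
    case base then show ?case using assms by (simp add: permutes_in_image)
  next
    case (step y)
    then have y: "y \<in> A" "p y \<in> A" using assms(1) by (simp_all add: permutes_in_image)
    show ?case
    proof (cases "y = x \<or> (p x, x) \<in> ?R\<^sup>*")
      case True then show ?thesis using step y by blast
    next
      case False
      then have "(y, p y) \<in> ?R" using y by blast
      then show ?thesis using step False y by (meson rtrancl_into_rtrancl)
    qed
  qed
  then show ?thesis using permutes_self_in_orbit[OF assms(1,2), of x] by blast
qed

section \<open>States of the ring diagram\<close>

fun mate :: "bool \<Rightarrow> quarter \<Rightarrow> quarter" where
  "mate True Out = Next" | "mate True Next = Out" | "mate True Inn = Prev" | "mate True Prev = Inn"
| "mate False Out = Prev" | "mate False Prev = Out" | "mate False Inn = Next" | "mate False Next = Inn"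

lemma mate_mate: "mate b (mate b q) = q"
  by (cases b; cases q) simp_all

definition state_steps :: "'d link_diagram \<Rightarrow> 'd set set \<Rightarrow> ('d \<times> 'd) set" where
  "state_steps D S = {(x, opp D x) | x. x \<in> darts D} \<union> {(x, resolve D S x) | x. x \<in> darts D}"

context ring_diagram
begin

text \<open>\<open>mate\<close> gives the two smoothings, with \<open>Out\<close> joined to
  \<open>Next\<close> or to \<open>Prev\<close>. Which of them is the B-resolution depends on
  \<open>U\<close> and so alternates around each ring.\<close>

lemma resolve_D:
  assumes "x \<in> A"
  shows "resolve D S (c (x, q)) = c (x, mate (x \<in> U \<longleftrightarrow> c ` ({x} \<times> UNIV) \<in> S) q)"
proof -
  have "inv (rot D) (c (x, q)) = c (x, turn (turn (turn q)))"
    using permutes_inj[OF D.r_perm] assms by (intro inv_f_eq) (simp_all add: turn4)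
  then show ?thesis
    using assms by (cases q; cases "x \<in> U"; cases "c ` ({x} \<times> UNIV) \<in> S")
      (simp_all add: resolve_def crossing_D)
qed

lemma sym_state_steps: "sym (state_steps D S)"
proof (rule symI)
  fix z z' assume "(z, z') \<in> state_steps D S"
  then have z: "z \<in> darts D" and z': "z' = opp D z \<or> z' = resolve D S z"
    by (auto simp: state_steps_def)
  obtain x q where x: "x \<in> A" "z = c (x, q)" using z by (rule dartE)
  show "(z', z) \<in> state_steps D S"
    using z'
  proof
    assume "z' = opp D z"
    moreover have "opp D (opp D z) = z" using opp_opp_D x by simp
    ultimately show ?thesis using z D.o_in[of z] unfolding state_steps_def by force
  next
    assume "z' = resolve D S z"
    moreover have "resolve D S (resolve D S z) = z" "resolve D S z \<in> darts D"
      using x by (simp_all add: resolve_D mate_mate)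
    ultimately show ?thesis unfolding state_steps_def by force
  qed
qed

text \<open>Treats both halves of adequacy: \<open>S\<close> is the all-A state for false
  \<open>s\<close> and the all-B state for true \<open>s\<close>. Changing the resolution at
  \<open>x0\<close> joins an inner to an outer curve and separates nothing.\<close>

lemma num_state_curves_less:
  assumes x0: "x0 \<in> A"
    and S: "\<And>x. x \<in> A \<Longrightarrow> c ` ({x} \<times> UNIV) \<in> S \<longleftrightarrow> s"
    and S': "\<And>x. x \<in> A \<Longrightarrow> c ` ({x} \<times> UNIV) \<in> S' \<longleftrightarrow> s \<noteq> (x = x0)"
  shows "num_state_curves D S' < num_state_curves D S"
proof -
  \<comment> \<open>The smoothing that \<open>S\<close> uses at \<open>x\<close>, as an argument of
    \<open>mate\<close>.\<close>
  define b where "b = (\<lambda>x. x \<in> U \<longleftrightarrow> s)"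
  have res: "resolve D S (c (x, q)) = c (x, mate (b x) q)"
    and res': "resolve D S' (c (x, q)) = c (x, mate (b x \<noteq> (x = x0)) q)" if "x \<in> A" for x q
    using that by (cases s; cases "x = x0"; simp add: resolve_D S S' b_def)+
  have b: "b (\<rho> x) \<longleftrightarrow> \<not> b x" "b (\<rho>' x) \<longleftrightarrow> \<not> b x" if "x \<in> A" for x
    using that by (auto simp: b_def)
  define E where "E = (\<lambda>z z'. (z, z') \<in> (state_steps D S')\<^sup>*)"
  have E_refl: "E z z" for z by (simp add: E_def)
  have E_sym: "E z' z" if "E z z'" for z z'
    using that symD[OF sym_rtrancl[OF sym_state_steps]] by (simp add: E_def)
  have E_trans [trans]: "E z z''" if "E z z'" "E z' z''" for z z' z''
    using that by (simp add: E_def)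
  have E_opp: "E (c (x, q)) (c (ring_opp (x, q)))" if "x \<in> A" for x q
  proof -
    have "(c (x, q), opp D (c (x, q))) \<in> state_steps D S'"
      using that c_in unfolding state_steps_def by blast
    then show ?thesis using that by (simp add: E_def)
  qed
  have E_res: "E (c (x, q)) (c (x, mate (b x \<noteq> (x = x0)) q))" if "x \<in> A" for x q
  proof -
    have "(c (x, q), resolve D S' (c (x, q))) \<in> state_steps D S'"
      using that c_in unfolding state_steps_def by blast
    then show ?thesis using that by (simp add: E_def res')
  qed
  have E_res': "E (c (x, q)) (c (x, mate (b x) q))" if "x \<in> A" "x \<noteq> x0" for x q
    using E_res[of x q] that by simp
  have E_res0: "E (c (x0, q)) (c (x0, mate (\<not> b x0) q))" for q
    using E_res[OF x0, of q] by simp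
  \<comment> \<open>The curve of \<open>S\<close> inside the ring can be traversed without its arc at \<open>x0\<close>, hence also in
    the state \<open>S'\<close>. It is a bigon if \<open>s\<close> is false, and the central curve otherwise.\<close>
  have inner: "E (c (x0, mate (b x0) Inn)) (c (x0, Inn))"
  proof (cases s)
    case False
    show ?thesis
    proof (cases "x0 \<in> U")
      case True
      let ?y = "\<rho> x0"
      have y: "?y \<in> A" "?y \<noteq> x0" using x0 rot_neq by simp_all
      have "E (c (x0, Next)) (c (?y, Prev))" using E_opp[OF x0, of Next] by simp
      also have "E (c (?y, Prev)) (c (?y, Inn))"
        using E_res'[OF y, of Prev] True x0 False by (simp add: b_def)
      also have "E (c (?y, Inn)) (c (x0, Inn))"
        using E_opp[OF y(1), of Inn] True x0 by simp
      finally show ?thesis using True False by (simp add: b_def)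
    next
      case nU: False
      let ?y = "\<rho>' x0"
      have y: "?y \<in> A" "?y \<noteq> x0" using x0 inv_rot_neq by simp_all
      have "E (c (x0, Prev)) (c (?y, Next))" using E_opp[OF x0, of Prev] by simp
      also have "E (c (?y, Next)) (c (?y, Inn))"
        using E_res'[OF y, of Next] nU x0 False by (simp add: b_def)
      also have "E (c (?y, Inn)) (c (x0, Inn))"
        using E_opp[OF y(1), of Inn] nU x0 by simp
      finally show ?thesis using nU False by (simp add: b_def)
    qed
  next
    case s: True
    show ?thesis
    proof (cases "x0 \<in> U")
      case True
      \<comment> \<open>One stretch of the central curve. It passes the crossing of
        \<open>?z\<close>, which is not \<open>x0\<close> because it lies on the other side of
        \<open>U\<close>.\<close>
      have move: "E (c (y, Prev)) (c (\<rho>' (\<rho>' y), Inn))" if "y \<in> A" "y \<in> U" for y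
      proof -
        let ?z = "\<rho>' y"
        have z: "?z \<in> A" "?z \<noteq> x0" "?z \<notin> U" using that True by auto
        have "E (c (y, Prev)) (c (?z, Next))" using E_opp[OF that(1), of Prev] by simp
        also have "E (c (?z, Next)) (c (?z, Inn))"
          using E_res'[OF z(1,2), of Next] z s by (simp add: b_def)
        also have "E (c (?z, Inn)) (c (\<rho>' ?z, Inn))"
          using E_opp[OF z(1), of Inn] z by simp
        finally show ?thesis .
      qed
      \<comment> \<open>The stretches advance by two darts; \<open>cycle\<close> returns to
        \<open>x0\<close> around the vertex without the arc at \<open>x0\<close>.\<close>
      let ?p = "\<rho>' \<circ> \<rho>'"
      have "?p permutes A" using permutes_compose permutes_inv[OF r_perm] by blast
      note cycle = cycle_avoiding_first_step[OF this finite_A x0]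
      have "y \<in> U \<and> E (c (x0, Prev)) (c (y, Inn))"
        if "(?p x0, y) \<in> {(y, ?p y) | y. y \<in> A \<and> y \<noteq> x0}\<^sup>*" for y
        using that
      proof induction
        case base then show ?case using move[OF x0 True] True x0 by simp
      next
        case (step y w)
        then have y: "y \<in> A" "y \<noteq> x0" "w = \<rho>' (\<rho>' y)" "y \<in> U"
          and E: "E (c (x0, Prev)) (c (y, Inn))" by auto
        note E
        also have "E (c (y, Inn)) (c (y, Prev))"
          using E_res'[OF y(1,2), of Inn] y s by (simp add: b_def)
        also have "E (c (y, Prev)) (c (w, Inn))" using move y by simp
        finally show ?case using y by simp
      qed
      from this[OF cycle] show ?thesis using True s by (simp add: b_def)
    next
      case False
      have move: "E (c (y, Next)) (c (\<rho> (\<rho> y), Inn))" if "y \<in> A" "y \<notin> U" for y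
      proof -
        let ?z = "\<rho> y"
        have z: "?z \<in> A" "?z \<noteq> x0" "?z \<in> U" using that False by auto
        have "E (c (y, Next)) (c (?z, Prev))" using E_opp[OF that(1), of Next] by simp
        also have "E (c (?z, Prev)) (c (?z, Inn))"
          using E_res'[OF z(1,2), of Prev] z s by (simp add: b_def)
        also have "E (c (?z, Inn)) (c (\<rho> ?z, Inn))"
          using E_opp[OF z(1), of Inn] z by simp
        finally show ?thesis .
      qed
      let ?p = "\<rho> \<circ> \<rho>"
      have "?p permutes A" using permutes_compose r_perm by blast
      note cycle = cycle_avoiding_first_step[OF this finite_A x0]
      have "y \<notin> U \<and> E (c (x0, Next)) (c (y, Inn))"
        if "(?p x0, y) \<in> {(y, ?p y) | y. y \<in> A \<and> y \<noteq> x0}\<^sup>*" for y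
        using that
      proof induction
        case base then show ?case using move[OF x0 False] False x0 by simp
      next
        case (step y w)
        then have y: "y \<in> A" "y \<noteq> x0" "w = \<rho> (\<rho> y)" "y \<notin> U"
          and E: "E (c (x0, Next)) (c (y, Inn))" by auto
        note E
        also have "E (c (y, Inn)) (c (y, Next))"
          using E_res'[OF y(1,2), of Inn] y s by (simp add: b_def)
        also have "E (c (y, Next)) (c (w, Inn))" using move y by simp
        finally show ?case using y by simp
      qed
      from this[OF cycle] show ?thesis using False s by (simp add: b_def)
    qed
  qed
  \<comment> \<open>The changed smoothing joins each end of the inner path to one of the two
    remaining quarters, so in \<open>S'\<close> all four quarters at \<open>x0\<close> lie on one
    curve.\<close>
  have all: "E (c (x0, q)) (c (x0, Inn))" for q
  proof -
    have 1: "E (c (x0, mate (\<not> b x0) Inn)) (c (x0, Inn))"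
      by (rule E_sym[OF E_res0])
    have 2: "E (c (x0, mate (\<not> b x0) (mate (b x0) Inn))) (c (x0, Inn))"
      by (rule E_trans[OF E_sym[OF E_res0] inner])
    show ?thesis
      using 1 2 inner E_refl[of "c (x0, Inn)"] by (cases "b x0"; cases q) simp_all
  qed
  have sub: "state_steps D S \<subseteq> (state_steps D S')\<^sup>*"
  proof
    fix w assume "w \<in> state_steps D S"
    then obtain z where z: "z \<in> darts D" and w: "w = (z, opp D z) \<or> w = (z, resolve D S z)"
      by (auto simp: state_steps_def)
    obtain x q where x: "x \<in> A" "z = c (x, q)" using z by (rule dartE)
    have "E z (opp D z)" using E_opp[OF x(1), of q] x by simp
    moreover have "E z (resolve D S z)"
    proof (cases "x = x0")
      case True
      then show ?thesis using E_trans[OF all E_sym[OF all]] x by (simp add: res)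
    next
      case False
      then show ?thesis using E_res'[OF x(1) False] x by (simp add: res)
    qed
    ultimately show "w \<in> (state_steps D S')\<^sup>*" using w by (auto simp: E_def)
  qed
  \<comment> \<open>The quarters on inner curves of \<open>S\<close>. They are closed under the
    steps of \<open>S\<close>; for ring segments this holds because \<open>b\<close> alternates
    around the ring.\<close>
  define inside where "inside = (\<lambda>(x, q). case q of Out \<Rightarrow> False | Inn \<Rightarrow> True | Next \<Rightarrow> \<not> b x | Prev \<Rightarrow> b x)"
  have "(c (x0, Inn), c (x0, Out)) \<notin> (state_steps D S)\<^sup>*"
  proof
    assume "(c (x0, Inn), c (x0, Out)) \<in> (state_steps D S)\<^sup>*"
    then have "\<exists>x q. x \<in> A \<and> c (x0, Out) = c (x, q) \<and> inside (x, q)"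
    proof induction
      case base
      show ?case using x0 by (intro exI[of _ x0] exI[of _ Inn]) (simp add: inside_def)
    next
      case (step z z')
      then obtain x q where x: "x \<in> A" "z = c (x, q)" "inside (x, q)" by blast
      have "z' = c (ring_opp (x, q)) \<or> z' = c (x, mate (b x) q)"
        using step(2) x by (auto simp: state_steps_def res)
      moreover have "fst (ring_opp (x, q)) \<in> A" using x(1) by (cases q) simp_all
      moreover have "inside (ring_opp (x, q))" using x(1,3) by (cases q) (simp_all add: inside_def b)
      moreover have "inside (x, mate (b x) q)"
        using x(3) by (cases q; cases "b x") (simp_all add: inside_def)
      ultimately show ?case using x(1) by (metis prod.collapse)
    qed
    then show False using x0 by (auto simp: c_eq inside_def)
  qed
  then have "card ((\<lambda>x. (state_steps D S')\<^sup>* `` {x}) ` darts D) < card ((\<lambda>x. (state_steps D S)\<^sup>* `` {x}) ` darts D)"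
    using x0 E_sym[OF all[of Out]]
    by (intro card_classes_less[OF finite_darts_D sub sym_state_steps sym_state_steps,
          of "c (x0, Inn)" "c (x0, Out)"]) (simp_all add: E_def)
  then show ?thesis
    by (simp add: num_state_curves_def state_curve_def state_steps_def)
qed

lemma adequate_D: "adequate D"
  unfolding adequate_def crossings_D
proof (intro conjI ballI)
  fix k assume "k \<in> (\<lambda>x. c ` ({x} \<times> UNIV)) ` A"
  then obtain x where x: "x \<in> A" and k: "k = c ` ({x} \<times> UNIV)" by blast
  show "num_state_curves D {k} < num_state_curves D {}"
    by (rule num_state_curves_less[OF x, where s = False]) (simp_all add: k crossing_eq x)
  show "num_state_curves D ((\<lambda>x. c ` ({x} \<times> UNIV)) ` A - {k})
      < num_state_curves D ((\<lambda>x. c ` ({x} \<times> UNIV)) ` A)"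
    by (rule num_state_curves_less[OF x, where s = True]) (simp_all add: k crossing_eq x)
qed

end

section \<open>Constructing the ring diagram of an even bipartite planar graph\<close>

lemma even_card_orbit:
  assumes "spherical_drawing G base M" and G: "finite_multigraph G"
    and even: "\<And>v. v \<in> verts G \<Longrightarrow> even (degree G v)" and d: "d \<in> darts M"
  shows "even (card (orbit (rot M) d))"
proof -
  have A: "darts M = edges G \<times> UNIV"
    and ends: "\<And>e. e \<in> edges G \<Longrightarrow> ends G e = {#base (e, False), base (e, True)#}"
    and orb: "orbit (rot M) d = {d' \<in> darts M. base d' = base d}"
    using assms(1) d unfolding spherical_drawing_def by blast+
  have fin: "finite (edges G)" using G by (simp add: finite_multigraph_def)
  let ?v = "base d"
  \<comment> \<open>Counting the darts at a vertex edge by edge counts a loop twice, as the degree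
    does.\<close>
  have "orbit (rot M) d = (SIGMA e:edges G. {b. base (e, b) = ?v})"
    unfolding orb A by auto
  then have "card (orbit (rot M) d) = (\<Sum>e\<in>edges G. card {b. base (e, b) = ?v})"
    using fin by (simp add: card_SigmaI)
  also have "\<dots> = degree G ?v"
    unfolding degree_def
  proof (rule sum.cong[OF refl])
    fix e assume "e \<in> edges G"
    have "{b. base (e, b) = ?v} =
      (if base (e, False) = ?v then {False} else {}) \<union> (if base (e, True) = ?v then {True} else {})"
      by (auto split: if_splits) (metis (full_types))+
    then show "card {b. base (e, b) = ?v} = count (ends G e) ?v"
      using ends[OF \<open>e \<in> edges G\<close>] by simp
  qed
  also have "even \<dots>"
  proof (rule even)
    obtain e b where e: "d = (e, b)" "e \<in> edges G" using d unfolding A by (cases d) auto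
    then have "?v \<in># ends G e" using ends[of e] by (cases b) auto
    then show "?v \<in> verts G" using G e by (auto simp: finite_multigraph_def)
  qed
  finally show ?thesis .
qed

theorem proposition3p3:
  fixes G :: "('v, 'e) multigraph"
  assumes "finite_multigraph G"
    and "planar G"
    and "bipartite G"
    and "\<And>v. v \<in> verts G \<Longrightarrow> even (degree G v)"
  shows "\<exists>D :: nat link_diagram. link_diagram D \<and> isomorphic (adg D) G \<and> adequate D"
proof -
  obtain base M where drawing: "spherical_drawing G base M"
    using assms(2) by (auto simp: planar_def)
  then have cm: "comb_map M" and sph: "spherical M" and A: "darts M = edges G \<times> UNIV"
    and opp: "\<And>e b. e \<in> edges G \<Longrightarrow> opp M (e, b) = (e, \<not> b)"
    and ends: "\<And>e. e \<in> edges G \<Longrightarrow> ends G e = {#base (e, False), base (e, True)#}"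
    and orb: "\<And>d. d \<in> darts M \<Longrightarrow> orbit (rot M) d = {d' \<in> darts M. base d' = base d}"
    unfolding spherical_drawing_def by blast+
  interpret combinatorial_map M by unfold_locales (rule cm)
  obtain X Y where XY: "X \<inter> Y = {}" "\<And>e. e \<in> edges G \<Longrightarrow> \<exists>x\<in>X. \<exists>y\<in>Y. ends G e = {#x, y#}"
    using assms(3) unfolding bipartite_def by (elim exE conjE) simp
  have side_opp: "base (\<alpha> d) \<in> X \<longleftrightarrow> base d \<notin> X" if dA: "d \<in> A" for d
  proof -
    obtain e b where d: "d = (e, b)" "e \<in> edges G" using dA unfolding A by (cases d) auto
    obtain x y where x: "x \<in> X" and y: "y \<in> Y" and "ends G e = {#x, y#}"
      using XY(2)[OF d(2)] by blast
    then have "base (e, False) = x \<and> base (e, True) = y \<or> base (e, False) = y \<and> base (e, True) = x"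
      by (auto simp: ends[OF d(2)] add_eq_conv_ex)
    moreover have "y \<notin> X" using y XY(1) by blast
    ultimately show ?thesis using x by (cases b) (auto simp: d(1) opp[OF d(2)])
  qed
  have base_rot: "base (\<rho> d) = base d" if "d \<in> A" for d
    using orbit.base[of \<rho> d] orb[OF that] by simp
  obtain B where B: "\<And>d. d \<in> A \<Longrightarrow> \<rho> d \<in> B \<longleftrightarrow> d \<notin> B" "\<And>d. d \<in> A \<Longrightarrow> \<alpha> d \<in> B \<longleftrightarrow> d \<notin> B"
    using two_colouring[OF sph even_card_orbit[OF drawing assms(1,4)]] by blast
  \<comment> \<open>Compares the colour of the face to the right with the class of the base vertex.
    \<open>\<alpha>\<close> changes both and thus preserves \<open>U\<close>; \<open>\<rho>\<close>
    changes only the colour.\<close>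
  define U where "U = {d. (d \<in> B) \<noteq> (base d \<in> X)}"
  have "finite (A \<times> (UNIV :: quarter set))" using finite_A by (simp add: UNIV_quarter)
  then obtain c :: "('e \<times> bool) \<times> quarter \<Rightarrow> nat" where c: "inj_on c (A \<times> UNIV)"
    using finite_imp_inj_to_nat_seg by blast
  define n where "n = card {v \<in> verts G. \<forall>d\<in>A. base d \<noteq> v}"
  have ring: "ring_diagram M U c"
  proof
    fix x assume x: "x \<in> A"
    show "\<rho> x \<in> U \<longleftrightarrow> x \<notin> U" using B(1)[OF x] base_rot[OF x] by (auto simp: U_def)
    show "\<alpha> x \<in> U \<longleftrightarrow> x \<in> U" using B(2)[OF x] side_opp[OF x] by (auto simp: U_def)
    \<comment> \<open>The left side is based at the other end of the edge, which belongs to the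
      other class.\<close>
    show "\<rho> (\<alpha> x) \<noteq> x" using base_rot[of "\<alpha> x"] side_opp[OF x] x by (auto simp: o_in)
  qed (use sph c in auto)
  then interpret ring_diagram M U c n .
  have "isomorphic (adg D) G"
    using isomorphic_adg_ring_diagram[OF ring drawing assms(1) n_def] .
  then show ?thesis using link_diagram_D adequate_D by blast
qed

end
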